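(* For every $k\ge2$, $$F^\Pi(k)\le\frac{k-1}{k}\,\rho_\Pi^{\,k-1}\,\|X_\star\|_F\,\mathbb E\|C_t\|_F .$$
   Context: A task is a pair $(X,y)$ with $X\in\mathbb R^{n\times d}$, $y\in\mathbb R^n$ ($n\ge1$ may depend on the task) and $\operatorname{rank}(X)<d$. $\Pi$ is a probability distribution on tasks. Common-solution assumption: there is a fixed vector $w^\star\in\mathbb R^d$ with $y=Xw^\star$ for every task under consideration. Tasks $(X_1,y_1),(X_2,y_2),\dots$ are i.i.d. from $\Pi$, with $X_t\in\mathbb R^{n_t\times d}$. Write $X^+$ for the Moore–Penrose pseudoinverse and set $$P_t:=I-X_t^+X_t,\qquad C_t:=\tfrac1{n_t}X_t^\top X_t,\qquad X_\star:=w^\star w^{\star\top};$$ $P_t$ is the orthogonal projector onto $\operatorname{null}(X_t)$. Exact-fit iterates: $w_0=0$ and, for $t\ge1$, $w_t:=\arg\min\{\tfrac12\|w-w_{t-1}\|_2^2:\ w\in\mathbb R^d,\ X_tw=y_t\}$; equivalently $w_t=w_{t-1}+X_t^+(y_t-X_tw_{t-1})=w^\star+P_t(w_{t-1}-w^\star)$. Forgetting: $\ell_t(w):=\tfrac1{n_t}\|X_tw-y_t\|_2^2$ and $F^\Pi(k):=\mathbb E\big[\tfrac1k\sum_{t=1}^k\ell_t(w_k)\big]$. All expectations appearing are assumed finite; in particular $\mathbb E\|C_t\|_F<\infty$ (this quantity does not depend on $t$). $\mathbb S^d$ is the space of symmetric $d\times d$ real matrices with the Frobenius inner product; $S_\Pi:\mathbb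 S^d\to\mathbb S^d$, $S_\Pi(A):=\mathbb E[P_tAP_t]$; $\rho_\Pi:=\|S_\Pi\|_{\mathrm{op},F}$ is the operator norm of $S_\Pi$ with respect to the Frobenius norm. *)

theory Defs
  imports "HOL-Probability.Probability" "Jordan_Normal_Form.DL_Rank"
begin

unbundle no vec_syntax
unbundle no inner_syntax

text \<open>
  The number of rows of \<open>X\<close> varies from task to task, so matrices and vectors are those of
  Jordan_Normal_Form, whose dimensions are terms rather than types.
\<close>

type_synonym rmat = "real Matrix.mat"
type_synonym rvec = "real Matrix.vec"
type_synonym task = "rmat \<times> rvec"

definition tasks :: "nat \<Rightarrow> task set" where
  "tasks d = {(X, y). \<exists>n\<ge>1. X \<in> carrier_mat n d \<and> y \<in> carrier_vec n \<and> vec_space.rank n X < d}"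

text \<open>
  The space of tasks is the disjoint union over \<open>n \<ge> 1\<close> of the pairs in
  \<open>\<real>\<^bsup>n\<times>d\<^esup> \<times> \<real>\<^bsup>n\<^esup>\<close> with rank-deficient first component. It carries the \<open>\<sigma>\<close>-algebra generated
  by the number of rows and by the entries, i.e. the one whose trace on each summand is the Borel
  \<open>\<sigma>\<close>-algebra. The guards \<open>i < dim_row X\<close> keep the generators away from out-of-range indices.
\<close>

definition task_space :: "nat \<Rightarrow> task measure" where
  "task_space d = sigma (tasks d)
     ({{(X, y) \<in> tasks d. dim_row X = n} | n. True}
      \<union> {{(X, y) \<in> tasks d. i < dim_row X \<and> X $$ (i, j) \<le> a} | i j a. j < d}
      \<union> {{(X, y) \<in> tasks d. i < dim_row X \<and> y $ i \<le> a} | i a. True})"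

definition is_pinv :: "rmat \<Rightarrow> rmat \<Rightarrow> bool" where
  "is_pinv A B \<longleftrightarrow>
     B \<in> carrier_mat (dim_col A) (dim_row A) \<and>
     A * B * A = A \<and> B * A * B = B \<and>
     transpose_mat (A * B) = A * B \<and> transpose_mat (B * A) = B * A"

definition pinv :: "rmat \<Rightarrow> rmat" where
  "pinv A = (THE B. is_pinv A B)"

definition proj_mat :: "task \<Rightarrow> rmat" where
  "proj_mat = (\<lambda>(X, y). 1\<^sub>m (dim_col X) - pinv X * X)"

definition cov_mat :: "task \<Rightarrow> rmat" where
  "cov_mat = (\<lambda>(X, y). (1 / real (dim_row X)) \<cdot>\<^sub>m (transpose_mat X * X))"

definition outer_prod :: "rvec \<Rightarrow> rvec \<Rightarrow> rmat" where
  "outer_prod u v = Matrix.mat (dim_vec u) (dim_vec v) (\<lambda>(i, j). u $ i * v $ j)"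

definition norm2_sq :: "rvec \<Rightarrow> real" where
  "norm2_sq v = scalar_prod v v"

definition frob_inner :: "rmat \<Rightarrow> rmat \<Rightarrow> real" where
  "frob_inner A B = (\<Sum>i<dim_row A. \<Sum>j<dim_col A. A $$ (i, j) * B $$ (i, j))"

definition frob_norm :: "rmat \<Rightarrow> real" where
  "frob_norm A = sqrt (frob_inner A A)"

definition loss :: "task \<Rightarrow> rvec \<Rightarrow> real" where
  "loss = (\<lambda>(X, y) w. 1 / real (dim_row X) * norm2_sq (X *\<^sub>v w - y))"

text \<open>Only \<open>T 1, T 2, \<dots>\<close> are used; \<open>T 0\<close> plays no role.\<close>

fun iterate :: "nat \<Rightarrow> (nat \<Rightarrow> task) \<Rightarrow> nat \<Rightarrow> rvec" where
  "iterate d T 0 = 0\<^sub>v d"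
| "iterate d T (Suc t) =
     arg_min_on (\<lambda>w. 1 / 2 * norm2_sq (w - iterate d T t))
       {w \<in> carrier_vec d. fst (T (Suc t)) *\<^sub>v w = snd (T (Suc t))}"

definition forgetting :: "nat \<Rightarrow> 'a measure \<Rightarrow> (nat \<Rightarrow> 'a \<Rightarrow> task) \<Rightarrow> nat \<Rightarrow> real" where
  "forgetting d M T k =
     (\<integral>\<omega>. 1 / real k * (\<Sum>t=1..k. loss (T t \<omega>) (iterate d (\<lambda>s. T s \<omega>) k)) \<partial>M)"

definition sym_mats :: "nat \<Rightarrow> rmat set" where
  "sym_mats d = {A \<in> carrier_mat d d. transpose_mat A = A}"

definition S_op :: "nat \<Rightarrow> task measure \<Rightarrow> rmat \<Rightarrow> rmat" where
  "S_op d \<mu> A = Matrix.mat d d (\<lambda>(i, j). \<integral>\<tau>. (proj_mat \<tau> * A * proj_mat \<tau>) $$ (i, j) \<partial>\<mu>)"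

text \<open>
  The analogue of \<^const>\<open>onorm\<close> on the space of symmetric matrices with the Frobenius norm; as
  there, the zero matrix contributes \<open>0 / 0 = 0\<close>.
\<close>

definition frob_onorm :: "nat \<Rightarrow> (rmat \<Rightarrow> rmat) \<Rightarrow> real" where
  "frob_onorm d S = (SUP A\<in>sym_mats d. frob_norm (S A) / frob_norm A)"

definition rho :: "nat \<Rightarrow> task measure \<Rightarrow> real" where
  "rho d \<mu> = frob_onorm d (S_op d \<mu>)"

end

theory Submission
  imports Defs
begin

text \<open>
  With \<open>P\<^sub>t\<close> the projector of task \<open>t\<close>, the error \<open>w\<^sub>k - w\<^sup>\<star>\<close> is \<open>- P\<^sub>k \<dots> P\<^sub>1 w\<^sup>\<star>\<close>, so the loss of \<open>w\<^sub>k\<close> on task \<open>t\<close>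
  is \<open>\<langle>C\<^sub>t, Z\<^sub>k\<rangle>\<close> with \<open>Z\<^sub>k = P\<^sub>k \<dots> P\<^sub>1 X\<^sub>\<star> P\<^sub>1 \<dots> P\<^sub>k\<close>, and it vanishes for \<open>t = k\<close> because \<open>X\<^sub>k P\<^sub>k = 0\<close>.
  By independence, averaging over the tasks before \<open>t\<close> replaces \<open>X\<^sub>\<star>\<close> by \<open>G = S\<^sup>t\<^sup>-\<^sup>1 X\<^sub>\<star>\<close>, and averaging over
  those after \<open>t\<close> applies \<open>S\<^sup>k\<^sup>-\<^sup>t\<close>; the expected loss is therefore \<open>E \<langle>C, S\<^sup>k\<^sup>-\<^sup>t (P G P)\<rangle>\<close> over a single
  random task. Since \<open>A \<mapsto> P A P\<close> is a Frobenius contraction, Cauchy-Schwarz bounds this by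
  \<open>\<rho>\<^sup>k\<^sup>-\<^sup>1 \<parallel>X\<^sub>\<star>\<parallel> E \<parallel>C\<parallel>\<close>, and there are \<open>k - 1\<close> contributing tasks.
\<close>

section \<open>The Moore-Penrose inverse\<close>

text \<open>The exponent is \<open>k - 1\<close> because the covariance and the projector of task
  \<open>t\<close> come from the same draw: their joint average is not an application of
  \<open>S_op\<close>, so that one step contributes only the contraction factor 1, while the t - 1
  earlier and k - t later steps contribute \<open>rho d \<mu>\<close> each. The same dependence
  shapes the averaging. The covariance is integrable but need not be bounded, so a single entry of
  it is carried as a scalar weight through all later steps; integrability survives because projector
  entries are bounded by 1. Independence is applied to real random variables only, entry by entry,
  after expanding a conjugation as a linear combination of matrix entries. This presupposes that the
  projector entries depend measurably on the task, although the pseudoinverse is given by a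
  description operator and the number of rows varies; the way out is the Gram matrix, which has size
  d by d for every task and already determines the projector.\<close>

text \<open>Gram-Schmidt on the rows \<open>x i\<close>: \<open>p\<close> is the projector onto the
  orthogonal complement of their span, and \<open>l\<close> records the coefficients that express I
  - p through the rows. Symmetry, the expansion and annihilation of the rows are an invariant that
  survives adding one row.\<close>

lemma gram_schmidt_projection:
  fixes x :: "nat \<Rightarrow> nat \<Rightarrow> real"
  shows "\<exists>p l. (\<forall>a<d. \<forall>b<d. p a b = p b a) \<and>
    (\<forall>a<d. \<forall>b<d. p a b = (if a = b then 1 else 0) - (\<Sum>i<n. x i a * l i b)) \<and>
    (\<forall>i<n. \<forall>b<d. (\<Sum>a<d. x i a * p a b) = (0::real))"
proof (induction n)
  case 0
  show ?case
    by (rule exI[of _ "\<lambda>a b. if a = b then 1 else 0"]) auto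
next
  case (Suc n)
  then obtain p l where sym: "\<And>a b. a < d \<Longrightarrow> b < d \<Longrightarrow> p a b = p b a"
    and pl: "\<And>a b. a < d \<Longrightarrow> b < d \<Longrightarrow> p a b = (if a = b then 1 else 0) - (\<Sum>i<n. x i a * l i b)"
    and ker: "\<And>i b. i < n \<Longrightarrow> b < d \<Longrightarrow> (\<Sum>a<d. x i a * p a b) = 0"
    by blast
  define r where "r a = (\<Sum>c<d. p a c * x n c)" for a
  define m where "m i = (\<Sum>c<d. l i c * x n c)" for i
  define R where "R = (\<Sum>a<d. r a * r a)"
  have r_eq: "r a = x n a - (\<Sum>i<n. x i a * m i)" if a: "a < d" for a
  proof -
    have "r a = (\<Sum>c<d. (if a = c then x n c else 0) - (\<Sum>i<n. x i a * l i c * x n c))"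
      unfolding r_def using a by (intro sum.cong) (auto simp: pl algebra_simps sum_distrib_left)
    also have "\<dots> = x n a - (\<Sum>i<n. \<Sum>c<d. x i a * l i c * x n c)"
      using a by (simp add: sum_subtractf sum.swap[of _ "{..<d}"])
    also have "\<dots> = x n a - (\<Sum>i<n. x i a * m i)"
      by (simp add: m_def sum_distrib_left mult.assoc)
    finally show ?thesis .
  qed
  have xr: "(\<Sum>a<d. x i a * r a) = 0" if i: "i < n" for i
  proof -
    have "(\<Sum>a<d. x i a * r a) = (\<Sum>a<d. \<Sum>c<d. x i a * p a c * x n c)"
      by (simp add: r_def sum_distrib_left mult.assoc)
    also have "\<dots> = (\<Sum>c<d. (\<Sum>a<d. x i a * p a c) * x n c)"
      by (subst sum.swap) (simp add: sum_distrib_right)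
    finally show ?thesis using ker[OF i] by simp
  qed
  have R_eq: "R = (\<Sum>a<d. x n a * r a)"
  proof -
    have "R = (\<Sum>a<d. x n a * r a - (\<Sum>i<n. m i * (x i a * r a)))"
      unfolding R_def by (intro sum.cong refl, subst r_eq)
        (auto simp: algebra_simps sum_distrib_left sum_distrib_right)
    also have "\<dots> = (\<Sum>a<d. x n a * r a) - (\<Sum>i<n. m i * (\<Sum>a<d. x i a * r a))"
      by (simp add: sum_subtractf sum.swap[of _ "{..<d}"] sum_distrib_left)
    finally show ?thesis by (simp add: xr)
  qed
  \<comment> \<open>If the new row lies in the span of the earlier ones, its residual
    \<open>r\<close> is zero and so is \<open>R\<close>; division by zero then yields 0, so the
    updates below keep \<open>p\<close> and the old coefficients.\<close>
  have R0: "r a = 0" if "R = 0" "a < d" for a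
    using that unfolding R_def by (subst (asm) sum_nonneg_eq_0_iff) auto
  define p' where "p' a b = p a b - r a * r b / R" for a b
  \<comment> \<open>These coefficients come from substituting r = x_n - \<Sum> m_i x_i, which is
    \<open>r_eq\<close>, for the first factor of the correction
    \<open>r a * r b / R\<close>.\<close>
  define l' where "l' i b = (if i = n then r b / R else l i b - m i * r b / R)" for i b
  have "p' a b = p' b a" if "a < d" "b < d" for a b
    using sym[OF that] by (simp add: p'_def)
  moreover have "p' a b = (if a = b then 1 else 0) - (\<Sum>i<Suc n. x i a * l' i b)"
    if ab: "a < d" "b < d" for a b
  proof -
    have "(\<Sum>i<Suc n. x i a * l' i b) = (\<Sum>i<n. x i a * l i b - x i a * m i * (r b / R)) + x n a * (r b / R)"
      by (simp add: l'_def right_diff_distrib mult.assoc)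
    also have "\<dots> = (\<Sum>i<n. x i a * l i b) + r a * (r b / R)"
      by (simp add: sum_subtractf r_eq[OF ab(1)] left_diff_distrib sum_distrib_right
          diff_divide_distrib sum_divide_distrib)
    finally show ?thesis by (simp add: p'_def pl[OF ab])
  qed
  moreover have "(\<Sum>a<d. x i a * p' a b) = 0" if i: "i < Suc n" and b: "b < d" for i b
  proof -
    have *: "(\<Sum>a<d. x i a * p' a b) = (\<Sum>a<d. x i a * p a b) - (\<Sum>a<d. x i a * r a) * (r b / R)"
      by (simp add: p'_def right_diff_distrib sum_subtractf sum_distrib_right sum_divide_distrib mult.assoc)
    show ?thesis
    proof (cases "i = n")
      case True
      have "(\<Sum>a<d. x n a * p a b) = r b"
        unfolding r_def by (intro sum.cong) (auto simp: sym[OF _ b])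
      then show ?thesis using * True R_eq R0[OF _ b] by auto
    next
      case False
      then show ?thesis using * i ker[OF _ b] xr by simp
    qed
  qed
  ultimately show ?case by blast
qed

text \<open>The product of the transpose of \<open>X\<close> with \<open>L\<close> is I - p, the
  projector onto the row space. The transpose of \<open>L\<close> is thus a generalized inverse of
  \<open>X\<close> satisfying one of the two symmetry conditions; applying the lemma to the
  transpose of \<open>X\<close> supplies the other.\<close>

lemma mult_transpose_mult_cancel:
  fixes X :: rmat
  assumes X: "X \<in> carrier_mat n d"
  shows "\<exists>L \<in> carrier_mat n d. X * (transpose_mat X * L) = X \<and> transpose_mat (transpose_mat X * L) = transpose_mat X * L"
proof -
  obtain p l where sym: "\<And>a b. a < d \<Longrightarrow> b < d \<Longrightarrow> p a b = p b a"
    and pl: "\<And>a b. a < d \<Longrightarrow> b < d \<Longrightarrow> p a b = (if a = b then 1 else 0) - (\<Sum>i<n. X $$ (i, a) * l i b)"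
    and ker: "\<And>i b. i < n \<Longrightarrow> b < d \<Longrightarrow> (\<Sum>a<d. X $$ (i, a) * p a b) = 0"
    using gram_schmidt_projection[where d = d and n = n and x = "\<lambda>i j. X $$ (i, j)"] by blast
  define L where "L = Matrix.mat n d (\<lambda>(i, j). l i j)"
  have L: "L \<in> carrier_mat n d" by (simp add: L_def)
  have XL: "(transpose_mat X * L) $$ (a, b) = (if a = b then 1 else 0) - p a b" if "a < d" "b < d" for a b
    using X that pl[OF that] by (simp add: L_def scalar_prod_def lessThan_atLeast0)
  have "X * (transpose_mat X * L) = X"
  proof (rule eq_matI)
    fix i b assume "i < dim_row X" "b < dim_col X"
    then have ib: "i < n" "b < d" using X by auto
    have "(X * (transpose_mat X * L)) $$ (i, b) = (\<Sum>a<d. X $$ (i, a) * (transpose_mat X * L) $$ (a, b))"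
      using X L ib by (simp add: scalar_prod_def lessThan_atLeast0)
    also have "\<dots> = (\<Sum>a<d. (if a = b then X $$ (i, a) else 0) - X $$ (i, a) * p a b)"
      using ib by (intro sum.cong) (auto simp: XL right_diff_distrib simp del: index_mult_mat)
    also have "\<dots> = X $$ (i, b)" using ker[OF ib] ib by (simp add: sum_subtractf)
    finally show "(X * (transpose_mat X * L)) $$ (i, b) = X $$ (i, b)" .
  qed (use X L in auto)
  moreover have "transpose_mat (transpose_mat X * L) = transpose_mat X * L"
    using X L by (intro eq_matI) (auto simp: XL sym simp del: index_mult_mat(1))
  ultimately show ?thesis using L by blast
qed

text \<open>Penrose's argument: transposing reverses a product of two symmetric factors, which
  forces AB = AC and BA = CA, and then B = BAB = CAC = C.\<close>

lemma is_pinv_unique: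
  assumes "is_pinv A B" "is_pinv A C"
  shows "B = C"
proof -
  define m n where "m = dim_row A" and "n = dim_col A"
  have A: "A \<in> carrier_mat m n" and B: "B \<in> carrier_mat n m" and C: "C \<in> carrier_mat n m"
    using assms by (auto simp: m_def n_def is_pinv_def)
  have b: "A * B * A = A" "B * A * B = B" "transpose_mat (A * B) = A * B" "transpose_mat (B * A) = B * A"
    and c: "A * C * A = A" "C * A * C = C" "transpose_mat (A * C) = A * C" "transpose_mat (C * A) = C * A"
    using assms by (auto simp: is_pinv_def)
  have AB: "A * B \<in> carrier_mat m m" and AC: "A * C \<in> carrier_mat m m"
    and BA: "B * A \<in> carrier_mat n n" and CA: "C * A \<in> carrier_mat n n"
    using A B C by auto
  have "A * B = A * C * A * B" by (simp add: c)
  also have "\<dots> = (A * C) * (A * B)" using assoc_mult_mat[OF AC A B] .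
  also have "\<dots> = transpose_mat ((A * B) * (A * C))" using transpose_mult[OF AB AC] b c by simp
  also have "(A * B) * (A * C) = A * B * A * C" using assoc_mult_mat[OF AB A C] by simp
  finally have 1: "A * B = A * C" by (simp add: b c)
  have "B * A = B * (A * C * A)" by (simp add: c)
  also have "\<dots> = (B * A) * (C * A)"
    using assoc_mult_mat[OF A C A] assoc_mult_mat[OF B A CA] by simp
  also have "\<dots> = transpose_mat ((C * A) * (B * A))" using transpose_mult[OF CA BA] b c by simp
  also have "(C * A) * (B * A) = C * (A * B * A)"
    using assoc_mult_mat[OF C A BA] assoc_mult_mat[OF A B A] by simp
  finally have 2: "B * A = C * A" by (simp add: b c)
  have "B = B * A * B" by (simp add: b)
  also have "\<dots> = C * (A * B)" using assoc_mult_mat[OF C A B] 2 by simp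
  also have "\<dots> = C * A * C" using assoc_mult_mat[OF C A C] 1 by simp
  finally show ?thesis by (simp add: c)
qed

lemma is_pinv_exists:
  shows "\<exists>B. is_pinv X B"
proof -
  define m n where "m = dim_row X" and "n = dim_col X"
  have X: "X \<in> carrier_mat m n" by (auto simp: m_def n_def)
  have Xt: "transpose_mat X \<in> carrier_mat n m" using X by simp
  obtain L where L: "L \<in> carrier_mat m n" and L1: "X * (transpose_mat X * L) = X"
    and L2: "transpose_mat (transpose_mat X * L) = transpose_mat X * L"
    using mult_transpose_mult_cancel[OF X] by blast
  obtain K where K: "K \<in> carrier_mat n m" and K1: "transpose_mat X * (X * K) = transpose_mat X"
    and K2: "transpose_mat (X * K) = X * K"
    using mult_transpose_mult_cancel[OF Xt] by auto
  define Lt where "Lt = transpose_mat L"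
  have Lt: "Lt \<in> carrier_mat n m" using L by (simp add: Lt_def)
  have LtX: "Lt * X = transpose_mat X * L" using L2 transpose_mult[OF Xt L] by (simp add: Lt_def)
  have c1: "X * Lt * X = X" using L1 LtX assoc_mult_mat[OF X Lt X] by simp
  have "transpose_mat (transpose_mat X * (X * K)) = X" using K1 by simp
  then have c2: "X * K * X = X" using transpose_mult[OF Xt, of "X * K" m] X K K2 by simp
  \<comment> \<open>\<open>Lt\<close> inverts \<open>X\<close> with \<open>Lt * X\<close> symmetric,
    and \<open>K\<close> inverts it with \<open>X * K\<close> symmetric. Their combination inherits
    both symmetries, since \<open>X * B = X * K\<close> and \<open>B * X = Lt * X\<close>.\<close>
  define B where "B = Lt * X * K"
  have B: "B \<in> carrier_mat n m" using Lt X K by (simp add: B_def)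
  have LX: "Lt * X \<in> carrier_mat n n" using Lt X by simp
  have XB: "X * B = X * K"
    using assoc_mult_mat[OF X LX K] assoc_mult_mat[OF X Lt X] c1 by (simp add: B_def)
  have BX: "B * X = Lt * X"
    using assoc_mult_mat[OF LX K X] assoc_mult_mat[OF Lt X, of "K * X" n] assoc_mult_mat[OF X K X] c2 X K
    by (simp add: B_def)
  have "X * B * X = X" using XB c2 by simp
  moreover have "B * X * B = B"
    unfolding BX using assoc_mult_mat[OF Lt X B] XB assoc_mult_mat[OF Lt X K] by (simp add: B_def)
  moreover have "transpose_mat (X * B) = X * B" using XB K2 by simp
  moreover have "transpose_mat (B * X) = B * X" using BX LtX L2 by simp
  ultimately show ?thesis unfolding is_pinv_def using B by (auto simp: m_def n_def)
qed

lemma is_pinv_pinv: "is_pinv X (pinv X)"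
  unfolding pinv_def using is_pinv_exists is_pinv_unique by (metis theI')

section \<open>Projectors and exact-fit steps\<close>

lemma scalar_prod_mult_mat_vec:
  fixes A :: rmat
  assumes "A \<in> carrier_mat m n" "u \<in> carrier_vec m" "v \<in> carrier_vec n"
  shows "u \<bullet> (A *\<^sub>v v) = (transpose_mat A *\<^sub>v u) \<bullet> v"
proof -
  have "u \<bullet> (A *\<^sub>v v) = (\<Sum>i<m. \<Sum>j<n. u $ i * A $$ (i, j) * v $ j)"
    using assms by (simp add: scalar_prod_def lessThan_atLeast0 sum_distrib_left mult.assoc)
  also have "\<dots> = (\<Sum>j<n. \<Sum>i<m. u $ i * A $$ (i, j) * v $ j)"
    by (rule sum.swap)
  also have "\<dots> = (transpose_mat A *\<^sub>v u) \<bullet> v"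
    using assms by (simp add: scalar_prod_def lessThan_atLeast0 sum_distrib_left mult_ac)
  finally show ?thesis .
qed

lemma norm2_sq_nonneg: "0 \<le> norm2_sq v"
  by (simp add: norm2_sq_def scalar_prod_def sum_nonneg)

lemma norm2_sq_eq_0:
  assumes "v \<in> carrier_vec n" "norm2_sq v = 0"
  shows "v = 0\<^sub>v n"
proof -
  have "(\<Sum>i<n. v $ i * v $ i) = 0"
    using assms by (simp add: norm2_sq_def scalar_prod_def lessThan_atLeast0)
  then have "\<forall>i<n. v $ i = 0" by (subst (asm) sum_nonneg_eq_0_iff) auto
  then show ?thesis using assms by (intro eq_vecI) auto
qed

lemma norm2_sq_add_orthogonal:
  assumes "u \<in> carrier_vec n" "v \<in> carrier_vec n" "u \<bullet> v = 0"
  shows "norm2_sq (u + v) = norm2_sq u + norm2_sq v"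
  using assms comm_scalar_prod[of u n v]
  by (simp add: norm2_sq_def add_scalar_prod_distrib[of _ n] scalar_prod_add_distrib[of _ n])

section \<open>Algebra of the null-space projector\<close>

lemma proj_mat_carrier: "X \<in> carrier_mat n d \<Longrightarrow> proj_mat (X, y) \<in> carrier_mat d d"
  using is_pinv_pinv[of X] by (auto simp: proj_mat_def is_pinv_def)

lemma pinv_mult_carrier: "X \<in> carrier_mat n d \<Longrightarrow> pinv X * X \<in> carrier_mat d d"
  using is_pinv_pinv[of X] by (auto simp: is_pinv_def)

lemma transpose_proj_mat:
  assumes "X \<in> carrier_mat n d"
  shows "transpose_mat (proj_mat (X, y)) = proj_mat (X, y)"
  using is_pinv_pinv[of X] pinv_mult_carrier[OF assms] assms transpose_minus[of "1\<^sub>m d" d d "pinv X * X"]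
  by (auto simp: proj_mat_def is_pinv_def)

lemma mult_proj_mat:
  assumes X: "X \<in> carrier_mat n d"
  shows "X * proj_mat (X, y) = 0\<^sub>m n d"
proof -
  have B: "pinv X \<in> carrier_mat d n" using is_pinv_pinv[of X] X by (auto simp: is_pinv_def)
  have "X * proj_mat (X, y) = X - X * (pinv X * X)"
    using X mult_minus_distrib_mat[OF X one_carrier_mat pinv_mult_carrier[OF X]] by (simp add: proj_mat_def)
  also have "X * (pinv X * X) = X"
    using assoc_mult_mat[OF X B X] is_pinv_pinv[of X] by (simp add: is_pinv_def)
  finally show ?thesis using X by simp
qed

lemma proj_mat_idem:
  assumes X: "X \<in> carrier_mat n d"
  shows "proj_mat (X, y) * proj_mat (X, y) = proj_mat (X, y)" (is "?P * ?P = _")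
proof -
  have B: "pinv X \<in> carrier_mat d n" using is_pinv_pinv[of X] X by (auto simp: is_pinv_def)
  have P: "?P \<in> carrier_mat d d" by (rule proj_mat_carrier[OF X])
  have "?P * ?P = (1\<^sub>m d - pinv X * X) * ?P" using X by (simp add: proj_mat_def)
  also have "\<dots> = ?P - pinv X * X * ?P"
    using minus_mult_distrib_mat[OF one_carrier_mat pinv_mult_carrier[OF X] P] P by simp
  also have "pinv X * X * ?P = 0\<^sub>m d d"
    using assoc_mult_mat[OF B X P] B by (simp add: mult_proj_mat[OF X])
  finally show ?thesis using P by (intro eq_matI) auto
qed

text \<open>The complement is the symmetric matrix \<open>pinv X * X\<close>, so transposing it
  moves the transpose of \<open>X\<close> to the left and shows that its range lies in the row
  space.\<close>

lemma complement_proj_mat: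
  assumes X: "X \<in> carrier_mat n d"
  shows "\<exists>L \<in> carrier_mat n d. 1\<^sub>m d - proj_mat (X, y) = transpose_mat X * L"
proof -
  have B: "pinv X \<in> carrier_mat d n" and s: "transpose_mat (pinv X * X) = pinv X * X"
    using is_pinv_pinv[of X] X by (auto simp: is_pinv_def)
  have "1\<^sub>m d - proj_mat (X, y) = pinv X * X"
    using X pinv_mult_carrier[OF X] by (intro eq_matI) (auto simp: proj_mat_def)
  also have "\<dots> = transpose_mat X * transpose_mat (pinv X)"
    using s transpose_mult[OF B X] by simp
  finally show ?thesis using B by (intro bexI[of _ "transpose_mat (pinv X)"]) auto
qed

lemma minus_proj_mat_vec:
  assumes X: "X \<in> carrier_mat n d" and v: "v \<in> carrier_vec d"
  obtains u where "u \<in> carrier_vec n" "v - proj_mat (X, y) *\<^sub>v v = transpose_mat X *\<^sub>v u"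
proof -
  obtain L where L: "L \<in> carrier_mat n d" "1\<^sub>m d - proj_mat (X, y) = transpose_mat X * L"
    using complement_proj_mat[OF X] by blast
  have "v - proj_mat (X, y) *\<^sub>v v = (1\<^sub>m d - proj_mat (X, y)) *\<^sub>v v"
    using minus_mult_distrib_mat_vec[OF one_carrier_mat proj_mat_carrier[OF X] v] v by simp
  also have "\<dots> = transpose_mat X *\<^sub>v (L *\<^sub>v v)" using L X v by simp
  finally show ?thesis using L v that[of "L *\<^sub>v v"] by simp
qed

text \<open>The row space is already the range of the Gram matrix. The coefficient vector thereby
  has length \<open>d\<close> whatever the number of rows, which a measurability argument across
  tasks of different sizes requires.\<close>

lemma minus_proj_mat_vec_gram:
  assumes X: "X \<in> carrier_mat n d" and v: "v \<in> carrier_vec d"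
  obtains u where "u \<in> carrier_vec d" "v - proj_mat (X, y) *\<^sub>v v = transpose_mat X * X *\<^sub>v u"
proof -
  obtain u where u: "u \<in> carrier_vec n" "v - proj_mat (X, y) *\<^sub>v v = transpose_mat X *\<^sub>v u"
    using minus_proj_mat_vec[OF X v] by blast
  have Xt: "transpose_mat X \<in> carrier_mat d n" using X by simp
  obtain K where K: "K \<in> carrier_mat d n" "transpose_mat X * (X * K) = transpose_mat X"
    using mult_transpose_mult_cancel[OF Xt] by auto
  have "transpose_mat X *\<^sub>v u = transpose_mat X * (X * K) *\<^sub>v u" using K by simp
  also have "\<dots> = transpose_mat X * X *\<^sub>v (K *\<^sub>v u)"
    using assoc_mult_mat[OF Xt X K(1)] assoc_mult_mat_vec[of "transpose_mat X * X" d d K n u] K X u by simp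
  finally show ?thesis using u K that[of "K *\<^sub>v u"] by simp
qed

section \<open>Orthogonality, contraction and distance to the row space\<close>

lemma proj_mat_vec_orthogonal:
  assumes X: "X \<in> carrier_mat n d" and v: "v \<in> carrier_vec d" and u: "u \<in> carrier_vec n"
  shows "(proj_mat (X, y) *\<^sub>v v) \<bullet> (transpose_mat X *\<^sub>v u) = 0"
proof -
  have P: "proj_mat (X, y) \<in> carrier_mat d d" by (rule proj_mat_carrier[OF X])
  have "(proj_mat (X, y) *\<^sub>v v) \<bullet> (transpose_mat X *\<^sub>v u) = (X *\<^sub>v (proj_mat (X, y) *\<^sub>v v)) \<bullet> u"
    using scalar_prod_mult_mat_vec[of "transpose_mat X" d n "proj_mat (X, y) *\<^sub>v v" u] X P u v by simp
  also have "X *\<^sub>v (proj_mat (X, y) *\<^sub>v v) = X * proj_mat (X, y) *\<^sub>v v"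
    using X P v by simp
  also have "\<dots> = 0\<^sub>v n" using mult_proj_mat[OF X] v by (intro eq_vecI) auto
  also have "\<dots> \<bullet> u = 0" using u by simp
  finally show ?thesis .
qed

lemma norm2_sq_proj_mat:
  assumes X: "X \<in> carrier_mat n d" and v: "v \<in> carrier_vec d"
  shows "norm2_sq (proj_mat (X, y) *\<^sub>v v) = v \<bullet> (proj_mat (X, y) *\<^sub>v v)"
proof -
  have P: "proj_mat (X, y) \<in> carrier_mat d d" by (rule proj_mat_carrier[OF X])
  have "norm2_sq (proj_mat (X, y) *\<^sub>v v) = (transpose_mat (proj_mat (X, y)) *\<^sub>v (proj_mat (X, y) *\<^sub>v v)) \<bullet> v"
    unfolding norm2_sq_def using scalar_prod_mult_mat_vec[OF P, of "proj_mat (X, y) *\<^sub>v v" v] P v by simp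
  also have "\<dots> = (proj_mat (X, y) * proj_mat (X, y) *\<^sub>v v) \<bullet> v"
    using P v by (simp add: transpose_proj_mat[OF X])
  also have "\<dots> = v \<bullet> (proj_mat (X, y) *\<^sub>v v)"
    using comm_scalar_prod[of _ d v] P v by (simp add: proj_mat_idem[OF X])
  finally show ?thesis .
qed

lemma norm2_sq_proj_mat_le:
  assumes X: "X \<in> carrier_mat n d" and v: "v \<in> carrier_vec d"
  shows "norm2_sq (proj_mat (X, y) *\<^sub>v v) \<le> norm2_sq v"
proof -
  have P: "proj_mat (X, y) \<in> carrier_mat d d" by (rule proj_mat_carrier[OF X])
  obtain u where u: "u \<in> carrier_vec n" "v - proj_mat (X, y) *\<^sub>v v = transpose_mat X *\<^sub>v u"
    using minus_proj_mat_vec[OF X v] by blast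
  have "v = proj_mat (X, y) *\<^sub>v v + (v - proj_mat (X, y) *\<^sub>v v)"
    using P v by (intro eq_vecI) auto
  moreover have "proj_mat (X, y) *\<^sub>v v \<in> carrier_vec d" "transpose_mat X *\<^sub>v u \<in> carrier_vec d"
    using P v u X by auto
  ultimately have "norm2_sq v = norm2_sq (proj_mat (X, y) *\<^sub>v v) + norm2_sq (transpose_mat X *\<^sub>v u)"
    using norm2_sq_add_orthogonal[OF _ _ proj_mat_vec_orthogonal[OF X v u(1)]] u by metis
  then show ?thesis using norm2_sq_nonneg[of "transpose_mat X *\<^sub>v u"] by simp
qed

text \<open>Subtracting a row-space vector changes only the component of \<open>v\<close> orthogonal
  to its projection, so Pythagoras applies. Together with \<open>minus_proj_mat_vec_gram\<close>,
  this makes the left side a minimum over \<open>w\<close>.\<close>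

lemma norm2_sq_proj_mat_le_dist:
  assumes X: "X \<in> carrier_mat n d" and v: "v \<in> carrier_vec d" and w: "w \<in> carrier_vec d"
  shows "norm2_sq (proj_mat (X, y) *\<^sub>v v) \<le> norm2_sq (v - transpose_mat X * X *\<^sub>v w)"
proof -
  have P: "proj_mat (X, y) \<in> carrier_mat d d" by (rule proj_mat_carrier[OF X])
  obtain u where u: "u \<in> carrier_vec n" "v - proj_mat (X, y) *\<^sub>v v = transpose_mat X *\<^sub>v u"
    using minus_proj_mat_vec[OF X v] by blast
  have Xt: "transpose_mat X \<in> carrier_mat d n" and Xw: "X *\<^sub>v w \<in> carrier_vec n" using X w by auto
  have uX: "u - X *\<^sub>v w \<in> carrier_vec n" using u Xw by simp
  have XXw: "transpose_mat X * X *\<^sub>v w = transpose_mat X *\<^sub>v (X *\<^sub>v w)"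
    using assoc_mult_mat_vec[OF Xt X w] .
  have "v - transpose_mat X * X *\<^sub>v w
      = proj_mat (X, y) *\<^sub>v v + (transpose_mat X *\<^sub>v u - transpose_mat X *\<^sub>v (X *\<^sub>v w))"
    unfolding XXw u(2)[symmetric] using P v X Xt Xw by (intro eq_vecI) auto
  also have "transpose_mat X *\<^sub>v u - transpose_mat X *\<^sub>v (X *\<^sub>v w) = transpose_mat X *\<^sub>v (u - X *\<^sub>v w)"
    using mult_minus_distrib_mat_vec[OF Xt u(1) Xw] by simp
  finally have eq: "v - transpose_mat X * X *\<^sub>v w
      = proj_mat (X, y) *\<^sub>v v + transpose_mat X *\<^sub>v (u - X *\<^sub>v w)" .
  have "proj_mat (X, y) *\<^sub>v v \<in> carrier_vec d" "transpose_mat X *\<^sub>v (u - X *\<^sub>v w) \<in> carrier_vec d"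
    using P v uX Xt by auto
  then have "norm2_sq (v - transpose_mat X * X *\<^sub>v w)
      = norm2_sq (proj_mat (X, y) *\<^sub>v v) + norm2_sq (transpose_mat X *\<^sub>v (u - X *\<^sub>v w))"
    unfolding eq by (rule norm2_sq_add_orthogonal[OF _ _ proj_mat_vec_orthogonal[OF X v uX]])
  then show ?thesis using norm2_sq_nonneg[of "transpose_mat X *\<^sub>v (u - X *\<^sub>v w)"] by simp
qed

text \<open>Symmetry and idempotence make each diagonal entry the sum of squares of its column.
  Hence it dominates its own square, so it is at most 1, and it bounds the square of every entry in
  that column.\<close>

lemma abs_proj_mat_le_1:
  assumes X: "X \<in> carrier_mat n d" and ij: "i < d" "j < d"
  shows "\<bar>proj_mat (X, y) $$ (i, j)\<bar> \<le> 1"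
proof -
  define p where "p a b = proj_mat (X, y) $$ (a, b)" for a b
  have P: "proj_mat (X, y) \<in> carrier_mat d d" by (rule proj_mat_carrier[OF X])
  have sym: "p a b = p b a" if "a < d" "b < d" for a b
    using transpose_proj_mat[OF X, of y] P that index_transpose_mat(1)[of a "proj_mat (X, y)" b]
    by (simp add: p_def)
  have "p j j = (\<Sum>a<d. p j a * p a j)"
    unfolding p_def using P ij arg_cong[OF proj_mat_idem[OF X, of y, symmetric], of "\<lambda>A. A $$ (j, j)"]
    by (simp add: scalar_prod_def lessThan_atLeast0)
  also have "\<dots> = (\<Sum>a<d. (p a j)\<^sup>2)" using sym ij by (auto simp: power2_eq_square intro!: sum.cong)
  finally have *: "p j j = (\<Sum>a<d. (p a j)\<^sup>2)" .
  have le: "(p a j)\<^sup>2 \<le> p j j" if "a < d" for a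
    unfolding * using that by (intro member_le_sum) auto
  have "p j j \<le> 1"
  proof (rule ccontr)
    assume "\<not> p j j \<le> 1"
    then have "p j j * 1 < p j j * p j j" by (intro mult_strict_left_mono) auto
    then show False using le[OF ij(2)] by (simp add: power2_eq_square)
  qed
  then have "(p i j)\<^sup>2 \<le> 1" using le[OF ij(1)] by linarith
  then show ?thesis unfolding p_def by (simp add: abs_square_le_1)
qed

text \<open>The step from \<open>w\<close> to the claimed point lies in the row space, while two
  feasible points differ by an element of the null space; by Pythagoras the minimiser is
  unique.\<close>

lemma arg_min_on_exact_fit:
  assumes X: "X \<in> carrier_mat n d" and v: "v \<in> carrier_vec d" and w: "w \<in> carrier_vec d"
  shows "arg_min_on (\<lambda>u. 1 / 2 * norm2_sq (u - w)) {u \<in> carrier_vec d. X *\<^sub>v u = X *\<^sub>v v}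
    = v + proj_mat (X, y) *\<^sub>v (w - v)"
proof -
  define P where "P = proj_mat (X, y)"
  define z where "z = v + P *\<^sub>v (w - v)"
  have P: "P \<in> carrier_mat d d" unfolding P_def by (rule proj_mat_carrier[OF X])
  have wv: "w - v \<in> carrier_vec d" using v w by simp
  have z: "z \<in> carrier_vec d" using P v wv by (simp add: z_def)
  have "X *\<^sub>v (P *\<^sub>v (w - v)) = X * P *\<^sub>v (w - v)" using X P wv by simp
  also have "\<dots> = 0\<^sub>v n" using mult_proj_mat[OF X] wv by (auto simp: P_def)
  finally have Xz: "X *\<^sub>v z = X *\<^sub>v v"
    unfolding z_def using mult_add_distrib_mat_vec[OF X v] P X v wv by simp
  obtain l where l: "l \<in> carrier_vec n" "w - v - P *\<^sub>v (w - v) = transpose_mat X *\<^sub>v l"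
    unfolding P_def using minus_proj_mat_vec[OF X wv] by blast
  have zw: "z - w = - (transpose_mat X *\<^sub>v l)"
    unfolding l(2)[symmetric] z_def using P v w by (intro eq_vecI) auto
  have pyth: "norm2_sq (u - w) = norm2_sq (z - w) + norm2_sq (u - z)"
    if u: "u \<in> carrier_vec d" "X *\<^sub>v u = X *\<^sub>v v" for u
  proof -
    have "X *\<^sub>v (u - z) = 0\<^sub>v n"
      using mult_minus_distrib_mat_vec[OF X u(1) z] u Xz X v by simp
    then have "(transpose_mat X *\<^sub>v l) \<bullet> (u - z) = 0"
      using scalar_prod_mult_mat_vec[OF X l(1), of "u - z"] u z l by simp
    then have "(z - w) \<bullet> (u - z) = 0"
      unfolding zw using X l u z by simp
    moreover have "u - w = (z - w) + (u - z)" using u z w by (intro eq_vecI) auto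
    ultimately show ?thesis using norm2_sq_add_orthogonal[of "z - w" d "u - z"] u z w by simp
  qed
  \<comment> \<open>\<open>arg_min_on\<close> is a choice operator, so membership among the
    minimisers would not identify its value; the predicate must coincide with equality to
    \<open>z\<close>.\<close>
  have "is_arg_min (\<lambda>u. 1 / 2 * norm2_sq (u - w)) (\<lambda>u. u \<in> {u \<in> carrier_vec d. X *\<^sub>v u = X *\<^sub>v v}) = (\<lambda>u. u = z)"
  proof (intro ext iffI)
    fix u
    assume a: "is_arg_min (\<lambda>u. 1 / 2 * norm2_sq (u - w)) (\<lambda>u. u \<in> {u \<in> carrier_vec d. X *\<^sub>v u = X *\<^sub>v v}) u"
    then have u: "u \<in> carrier_vec d" "X *\<^sub>v u = X *\<^sub>v v" and "\<not> norm2_sq (z - w) < norm2_sq (u - w)"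
      using z Xz by (auto simp: is_arg_min_def)
    then have "norm2_sq (u - z) = 0" using pyth[OF u] norm2_sq_nonneg[of "u - z"] by simp
    then have 0: "u - z = 0\<^sub>v d" using norm2_sq_eq_0[of "u - z" d] u z by simp
    show "u = z"
    proof (rule eq_vecI)
      fix i assume "i < dim_vec z"
      then show "u $ i = z $ i" using arg_cong[OF 0, of "\<lambda>x. x $ i"] u z by simp
    qed (use u z in auto)
  next
    fix u assume "u = z"
    moreover have "norm2_sq (z - w) \<le> norm2_sq (x - w)"
      if "x \<in> carrier_vec d" "X *\<^sub>v x = X *\<^sub>v v" for x
      unfolding pyth[OF that] using norm2_sq_nonneg[of "x - z"] by simp
    ultimately show "is_arg_min (\<lambda>u. 1 / 2 * norm2_sq (u - w)) (\<lambda>u. u \<in> {u \<in> carrier_vec d. X *\<^sub>v u = X *\<^sub>v v}) u"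
      using z Xz by (auto simp: is_arg_min_def not_less)
  qed
  then show ?thesis unfolding arg_min_on_def arg_min_def by (simp only: some_eq_trivial z_def P_def)
qed

section \<open>The Frobenius norm\<close>

lemma frob_inner_self_nonneg: "0 \<le> frob_inner A A"
  by (simp add: frob_inner_def sum_nonneg)

lemma frob_norm_nonneg: "0 \<le> frob_norm A"
  by (simp add: frob_norm_def frob_inner_self_nonneg)

lemma frob_norm_eq_L2_set:
  assumes "A \<in> carrier_mat m n"
  shows "frob_norm A = L2_set (\<lambda>(i, j). A $$ (i, j)) ({..<m} \<times> {..<n})"
  using assms by (simp add: frob_norm_def frob_inner_def L2_set_def sum.cartesian_product power2_eq_square split_beta)

lemma frob_inner_le:
  assumes A: "A \<in> carrier_mat m n" and B: "B \<in> carrier_mat m n"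
  shows "frob_inner A B \<le> frob_norm A * frob_norm B"
proof -
  let ?I = "{..<m} \<times> {..<n}"
  have "frob_inner A B = (\<Sum>x\<in>?I. A $$ x * B $$ x)"
    using A B by (simp add: frob_inner_def sum.cartesian_product split_beta)
  also have "\<dots> \<le> (\<Sum>x\<in>?I. \<bar>A $$ x\<bar> * \<bar>B $$ x\<bar>)"
    by (intro sum_mono) (metis abs_ge_self abs_mult)
  also have "\<dots> \<le> L2_set (\<lambda>x. A $$ x) ?I * L2_set (\<lambda>x. B $$ x) ?I"
    by (rule L2_set_mult_ineq)
  finally show ?thesis using frob_norm_eq_L2_set[OF A] frob_norm_eq_L2_set[OF B] by (simp add: split_beta)
qed

lemma abs_index_le_frob_norm:
  assumes A: "A \<in> carrier_mat m n" and ij: "i < m" "j < n"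
  shows "\<bar>A $$ (i, j)\<bar> \<le> frob_norm A"
proof -
  have "\<bar>(\<lambda>(i, j). A $$ (i, j)) (i, j)\<bar> \<le> L2_set (\<lambda>x. \<bar>(\<lambda>(i, j). A $$ (i, j)) x\<bar>) ({..<m} \<times> {..<n})"
    by (rule member_le_L2_set) (use ij in auto)
  then show ?thesis by (simp add: frob_norm_eq_L2_set[OF A] L2_set_def split_beta)
qed

lemma frob_norm_le_sum:
  assumes A: "A \<in> carrier_mat m n"
  shows "frob_norm A \<le> (\<Sum>i<m. \<Sum>j<n. \<bar>A $$ (i, j)\<bar>)"
  unfolding frob_norm_eq_L2_set[OF A] sum.cartesian_product
  using L2_set_le_sum_abs[of "\<lambda>(i, j). A $$ (i, j)"] by (simp add: split_beta)

lemma frob_norm_transpose: "frob_norm (transpose_mat A) = frob_norm A"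
  unfolding frob_norm_def frob_inner_def by (simp add: sum.swap[of _ "{..<dim_col A}"])

lemma frob_norm_proj_mult_le:
  assumes X: "X \<in> carrier_mat n d" and G: "G \<in> carrier_mat d m"
  shows "frob_norm (proj_mat (X, y) * G) \<le> frob_norm G"
proof -
  have P: "proj_mat (X, y) \<in> carrier_mat d d" by (rule proj_mat_carrier[OF X])
  have col: "frob_inner A A = (\<Sum>j<m. norm2_sq (col A j))" if "A \<in> carrier_mat d m" for A
    using that by (simp add: frob_inner_def norm2_sq_def scalar_prod_def lessThan_atLeast0
        sum.swap[of _ "{0..<d}"])
  have "frob_inner (proj_mat (X, y) * G) (proj_mat (X, y) * G)
      = (\<Sum>j<m. norm2_sq (proj_mat (X, y) *\<^sub>v col G j))"
    using P G by (subst col) (auto simp: col_mult2[OF P G] simp del: col_mult intro!: sum.cong)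
  also have "\<dots> \<le> (\<Sum>j<m. norm2_sq (col G j))"
    using G by (intro sum_mono norm2_sq_proj_mat_le[OF X]) auto
  finally show ?thesis using col[OF G] by (simp add: frob_norm_def)
qed

text \<open>Left multiplication contracts column by column; the right factor becomes a left factor
  under transposition, which preserves the Frobenius norm and the symmetric projector.\<close>

lemma frob_norm_sandwich_le:
  assumes X: "X \<in> carrier_mat n d" and G: "G \<in> carrier_mat d d"
  shows "frob_norm (proj_mat (X, y) * G * proj_mat (X, y)) \<le> frob_norm G"
proof -
  let ?P = "proj_mat (X, y)"
  have P: "?P \<in> carrier_mat d d" by (rule proj_mat_carrier[OF X])
  have PG: "?P * G \<in> carrier_mat d d" using P G by simp
  have "frob_norm (?P * G * ?P) = frob_norm (transpose_mat (?P * G * ?P))" by (simp only: frob_norm_transpose)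
  also have "\<dots> = frob_norm (?P * transpose_mat (?P * G))"
    by (subst transpose_mult[OF PG P]) (simp add: transpose_proj_mat[OF X])
  also have "\<dots> \<le> frob_norm (transpose_mat (?P * G))"
    using PG by (intro frob_norm_proj_mult_le[OF X]) (use P G in auto)
  also have "\<dots> \<le> frob_norm G"
    unfolding frob_norm_transpose by (rule frob_norm_proj_mult_le[OF X G])
  finally show ?thesis .
qed

section \<open>Measurability of the projector\<close>

lemma task_space_generators:
  "{{(X, y) \<in> tasks d. dim_row X = n} | n. True}
      \<union> {{(X, y) \<in> tasks d. i < dim_row X \<and> X $$ (i, j) \<le> a} | i j a. j < d}
      \<union> {{(X, y) \<in> tasks d. i < dim_row X \<and> y $ i \<le> a} | i a. True} \<subseteq> Pow (tasks d)"
  by blast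

lemma space_task_space: "space (task_space d) = tasks d"
  unfolding task_space_def by (rule space_measure_of[OF task_space_generators])

lemma sets_task_space_dim_row: "{(X, y) \<in> tasks d. dim_row X = n} \<in> sets (task_space d)"
  unfolding task_space_def sets_measure_of[OF task_space_generators] by (intro sigma_sets.Basic) blast

lemma sets_task_space_entry:
  "j < d \<Longrightarrow> {(X, y) \<in> tasks d. i < dim_row X \<and> X $$ (i, j) \<le> a} \<in> sets (task_space d)"
  unfolding task_space_def sets_measure_of[OF task_space_generators] by (intro sigma_sets.Basic) blast

lemma tasksE:
  assumes "\<tau> \<in> tasks d"
  obtains X y n where "\<tau> = (X, y)" "n \<ge> 1" "X \<in> carrier_mat n d" "y \<in> carrier_vec n"
  using assms by (auto simp: tasks_def)

section \<open>Measurability of the Gram and covariance entries\<close>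

lemma measurable_dim_row:
  "(\<lambda>\<tau>. dim_row (fst \<tau>)) \<in> measurable (task_space d) (count_space UNIV)"
proof -
  have "(\<lambda>\<tau>. dim_row (fst \<tau>)) -` {n} \<inter> space (task_space d) = {(X, y) \<in> tasks d. dim_row X = n}" for n
    by (auto simp: space_task_space)
  then show ?thesis
    by (subst measurable_count_space_eq_countable) (auto simp: sets_task_space_dim_row)
qed

lemma borel_measurable_entry:
  assumes j: "j < d"
  shows "(\<lambda>\<tau>. if i < dim_row (fst \<tau>) then fst \<tau> $$ (i, j) else 0) \<in> borel_measurable (task_space d)"
    (is "?f \<in> _")
proof (subst borel_measurable_iff_le, intro allI)
  fix a :: real
  let ?E = "{(X, y) \<in> tasks d. i < dim_row X \<and> X $$ (i, j) \<le> a}"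
  \<comment> \<open>Tasks with at most \<open>i\<close> rows, where the padded entry is 0; they
    belong to the sublevel set exactly when \<open>0 \<le> a\<close>.\<close>
  let ?N = "\<Union>n\<in>{..i}. {(X, y) \<in> tasks d. dim_row X = n}"
  have "?E \<in> sets (task_space d)" "?N \<in> sets (task_space d)"
    using sets_task_space_entry[OF j] sets_task_space_dim_row by (auto intro!: sets.finite_UN)
  moreover have "{\<tau> \<in> space (task_space d). ?f \<tau> \<le> a} = (if 0 \<le> a then ?E \<union> ?N else ?E)"
    by (auto simp: space_task_space not_less split: if_splits)
  ultimately show "{\<tau> \<in> space (task_space d). ?f \<tau> \<le> a} \<in> sets (task_space d)" by auto
qed

lemma gram_index:
  assumes "X \<in> carrier_mat n d" "i < d" "j < d"
  shows "(transpose_mat X * X) $$ (i, j) = (\<Sum>l<n. X $$ (l, i) * X $$ (l, j) :: real)"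
  using assms by (simp add: scalar_prod_def lessThan_atLeast0)

text \<open>The length of the sum over rows is itself random. It takes countably many values, so it
  suffices to treat each fixed length, with entries beyond the last row padded by 0.\<close>

lemma borel_measurable_gram:
  assumes ij: "i < d" "j < d"
  shows "(\<lambda>\<tau>. (transpose_mat (fst \<tau>) * fst \<tau>) $$ (i, j)) \<in> borel_measurable (task_space d)"
proof -
  define e where "e l a \<tau> = (if l < dim_row (fst \<tau>) then fst \<tau> $$ (l, a) else 0)" for l a and \<tau> :: task
  have [measurable]: "e l a \<in> borel_measurable (task_space d)" if "a < d" for l a
    unfolding e_def using borel_measurable_entry[OF that] by simp
  have "(\<lambda>\<tau>. \<Sum>l<dim_row (fst \<tau>). e l i \<tau> * e l j \<tau>) \<in> borel_measurable (task_space d)"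
    by (rule measurable_compose_countable[OF _ measurable_dim_row]) (use ij in measurable)
  moreover have "(transpose_mat (fst \<tau>) * fst \<tau>) $$ (i, j) = (\<Sum>l<dim_row (fst \<tau>). e l i \<tau> * e l j \<tau>)"
    if "\<tau> \<in> space (task_space d)" for \<tau>
    using that ij by (auto simp: space_task_space e_def gram_index simp del: index_mult_mat elim!: tasksE)
  ultimately show ?thesis by (simp cong: measurable_cong)
qed

lemma borel_measurable_cov_mat:
  assumes ij: "i < d" "j < d"
  shows "(\<lambda>\<tau>. cov_mat \<tau> $$ (i, j)) \<in> borel_measurable (task_space d)"
proof -
  have "(\<lambda>\<tau>. 1 / real (dim_row (fst \<tau>))) \<in> borel_measurable (task_space d)"
    by (rule measurable_compose[OF measurable_dim_row]) simp
  then have "(\<lambda>\<tau>. 1 / real (dim_row (fst \<tau>)) * (transpose_mat (fst \<tau>) * fst \<tau>) $$ (i, j))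
      \<in> borel_measurable (task_space d)"
    using borel_measurable_gram[OF ij] by (rule borel_measurable_times)
  moreover have "cov_mat \<tau> $$ (i, j) = 1 / real (dim_row (fst \<tau>)) * (transpose_mat (fst \<tau>) * fst \<tau>) $$ (i, j)"
    if "\<tau> \<in> space (task_space d)" for \<tau>
    using that ij by (auto simp: space_task_space cov_mat_def elim!: tasksE)
  ultimately show ?thesis by (simp cong: measurable_cong)
qed

text \<open>The squared distance from \<open>v\<close> to \<open>A\<close> applied to
  \<open>u\<close>. The coefficients are a function rather than a vector so that the rational ones
  form a countable \<open>PiE\<close> set.\<close>

definition residual_sq :: "nat \<Rightarrow> rmat \<Rightarrow> rvec \<Rightarrow> (nat \<Rightarrow> real) \<Rightarrow> real" where
  "residual_sq d A v u = (\<Sum>i<d. (v $ i - (\<Sum>j<d. A $$ (i, j) * u j))\<^sup>2)"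

lemma norm2_sq_residual:
  assumes "A \<in> carrier_mat d d" "v \<in> carrier_vec d" "w \<in> carrier_vec d"
  shows "norm2_sq (v - A *\<^sub>v w) = residual_sq d A v (\<lambda>j. w $ j)"
  using assms by (simp add: norm2_sq_def residual_sq_def scalar_prod_def lessThan_atLeast0 power2_eq_square)

text \<open>Restricting to rational coefficients turns the least-squares distance to the row space into
  a countable infimum, which makes the projector a measurable function of the task.\<close>

lemma proj_mat_quadratic_form:
  assumes X: "X \<in> carrier_mat n d" and v: "v \<in> carrier_vec d"
  shows "v \<bullet> (proj_mat (X, y) *\<^sub>v v)
    = (INF u\<in>{..<d} \<rightarrow>\<^sub>E \<rat>. residual_sq d (transpose_mat X * X) v u)"
proof (rule antisym)
  define A where "A = transpose_mat X * X"
  have A: "A \<in> carrier_mat d d" using X by (simp add: A_def)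
  have ne: "({..<d} \<rightarrow>\<^sub>E (\<rat> :: real set)) \<noteq> {}" by (auto simp: PiE_eq_empty_iff)
  have "v \<bullet> (proj_mat (X, y) *\<^sub>v v) \<le> residual_sq d A v u" for u
  proof -
    have "residual_sq d A v u = norm2_sq (v - A *\<^sub>v vec d u)"
      using norm2_sq_residual[OF A v, of "vec d u"] by (simp add: residual_sq_def)
    then show ?thesis
      using norm2_sq_proj_mat_le_dist[OF X v, of "vec d u" y] norm2_sq_proj_mat[OF X v, of y] by (simp add: A_def)
  qed
  then show "v \<bullet> (proj_mat (X, y) *\<^sub>v v) \<le> (INF u\<in>{..<d} \<rightarrow>\<^sub>E \<rat>. residual_sq d (transpose_mat X * X) v u)"
    using ne by (intro cINF_greatest) (auto simp: A_def)
  obtain b where b: "b \<in> carrier_vec d" "v - proj_mat (X, y) *\<^sub>v v = A *\<^sub>v b"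
    unfolding A_def using minus_proj_mat_vec_gram[OF X v] by blast
  have P: "proj_mat (X, y) \<in> carrier_mat d d" by (rule proj_mat_carrier[OF X])
  have "v - A *\<^sub>v b = proj_mat (X, y) *\<^sub>v v"
    unfolding b(2)[symmetric] using P v by (intro eq_vecI) auto
  then have val: "residual_sq d A v (\<lambda>j. b $ j) = v \<bullet> (proj_mat (X, y) *\<^sub>v v)"
    using norm2_sq_residual[OF A v b(1)] norm2_sq_proj_mat[OF X v, of y] by simp
  \<comment> \<open>Rounding the minimiser \<open>b\<close> down to multiples of 1/(m+1) gives
    admissible rational points converging to it; continuity of the residual then bounds the infimum
    by its value at \<open>b\<close>. Restriction to \<open>{..<d}\<close> provides the
    extensionality that \<open>PiE\<close> demands.\<close>
  define u where "u m = (\<lambda>j\<in>{..<d}. real_of_int \<lfloor>real (Suc m) * b $ j\<rfloor> / real (Suc m))" for m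
  have lim: "(\<lambda>m. u m j) \<longlonglongrightarrow> b $ j" if "j < d" for j
  proof (rule tendsto_sandwich)
    show "(\<lambda>m. b $ j - 1 / real (Suc m)) \<longlonglongrightarrow> b $ j"
      using tendsto_diff[OF tendsto_const LIMSEQ_Suc[OF lim_1_over_n], of "b $ j"] by simp
    show "\<forall>\<^sub>F m in sequentially. b $ j - 1 / real (Suc m) \<le> u m j"
    proof (intro always_eventually allI)
      fix m
      have "(real (Suc m) * b $ j - 1) / real (Suc m) \<le> real_of_int \<lfloor>real (Suc m) * b $ j\<rfloor> / real (Suc m)"
        by (intro divide_right_mono) linarith+
      then show "b $ j - 1 / real (Suc m) \<le> u m j" using that by (simp add: u_def diff_divide_distrib)
    qed
    show "\<forall>\<^sub>F m in sequentially. u m j \<le> b $ j"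
    proof (intro always_eventually allI)
      fix m
      have "real_of_int \<lfloor>real (Suc m) * b $ j\<rfloor> / real (Suc m) \<le> (real (Suc m) * b $ j) / real (Suc m)"
        by (intro divide_right_mono) linarith+
      then show "u m j \<le> b $ j" using that by (simp add: u_def)
    qed
  qed simp
  have "(\<lambda>m. residual_sq d A v (u m)) \<longlonglongrightarrow> residual_sq d A v (\<lambda>j. b $ j)"
    unfolding residual_sq_def by (intro tendsto_intros lim) auto
  moreover have "(INF u\<in>{..<d} \<rightarrow>\<^sub>E \<rat>. residual_sq d A v u) \<le> residual_sq d A v (u m)" for m
  proof (rule cINF_lower)
    show "bdd_below (residual_sq d A v ` ({..<d} \<rightarrow>\<^sub>E \<rat>))"
      by (intro bdd_belowI2[of _ 0]) (simp add: residual_sq_def sum_nonneg)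
    show "u m \<in> {..<d} \<rightarrow>\<^sub>E \<rat>" by (auto simp: u_def)
  qed
  ultimately show "(INF u\<in>{..<d} \<rightarrow>\<^sub>E \<rat>. residual_sq d (transpose_mat X * X) v u) \<le> v \<bullet> (proj_mat (X, y) *\<^sub>v v)"
    unfolding val[symmetric] A_def[symmetric] by (intro LIMSEQ_le_const) auto
qed

lemma borel_measurable_proj_quadratic_form:
  assumes v: "v \<in> carrier_vec d"
  shows "(\<lambda>\<tau>. v \<bullet> (proj_mat \<tau> *\<^sub>v v)) \<in> borel_measurable (task_space d)"
proof -
  have "countable ({..<d} \<rightarrow>\<^sub>E (\<rat> :: real set))" by (intro countable_PiE countable_rat) auto
  moreover have "(\<lambda>\<tau>. residual_sq d (transpose_mat (fst \<tau>) * fst \<tau>) v u) \<in> borel_measurable (task_space d)" for u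
    unfolding residual_sq_def
    by (intro borel_measurable_sum borel_measurable_power borel_measurable_diff borel_measurable_times
        borel_measurable_const borel_measurable_gram) auto
  ultimately have "(\<lambda>\<tau>. INF u\<in>{..<d} \<rightarrow>\<^sub>E \<rat>. residual_sq d (transpose_mat (fst \<tau>) * fst \<tau>) v u) \<in> borel_measurable (task_space d)"
    by (rule borel_measurable_cINF_real)
  moreover have "v \<bullet> (proj_mat \<tau> *\<^sub>v v) = (INF u\<in>{..<d} \<rightarrow>\<^sub>E \<rat>. residual_sq d (transpose_mat (fst \<tau>) * fst \<tau>) v u)"
    if "\<tau> \<in> space (task_space d)" for \<tau>
    using that by (auto simp: space_task_space proj_mat_quadratic_form[OF _ v] elim!: tasksE)
  ultimately show ?thesis by (simp cong: measurable_cong)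
qed

text \<open>Polarization: for a symmetric matrix, the quadratic form at the unit vectors and at
  their sum determines the off-diagonal entries as well.\<close>

lemma borel_measurable_proj_mat:
  assumes ij: "i < d" "j < d"
  shows "(\<lambda>\<tau>. proj_mat \<tau> $$ (i, j)) \<in> borel_measurable (task_space d)"
proof -
  define q where "q v \<tau> = v \<bullet> (proj_mat \<tau> *\<^sub>v v)" for v and \<tau> :: task
  let ?ei = "unit_vec d i" and ?ej = "unit_vec d j"
  have [measurable]: "q v \<in> borel_measurable (task_space d)" if "v \<in> carrier_vec d" for v
    unfolding q_def by (rule borel_measurable_proj_quadratic_form[OF that])
  have meas: "(\<lambda>\<tau>. (q (?ei + ?ej) \<tau> - q ?ei \<tau> - q ?ej \<tau>) / 2) \<in> borel_measurable (task_space d)"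
    by measurable
  have eq: "proj_mat \<tau> $$ (i, j) = (q (?ei + ?ej) \<tau> - q ?ei \<tau> - q ?ej \<tau>) / 2"
    if \<tau>: "\<tau> \<in> space (task_space d)" for \<tau>
  proof -
    obtain X y n where t: "\<tau> = (X, y)" and X: "X \<in> carrier_mat n d"
      using \<tau> unfolding space_task_space by (rule tasksE)
    have P: "proj_mat \<tau> \<in> carrier_mat d d" unfolding t by (rule proj_mat_carrier[OF X])
    have e: "unit_vec d a \<bullet> (proj_mat \<tau> *\<^sub>v unit_vec d b) = proj_mat \<tau> $$ (a, b)" if "a < d" "b < d" for a b
      using that P by simp
    have sym: "proj_mat \<tau> $$ (j, i) = proj_mat \<tau> $$ (i, j)"
      using transpose_proj_mat[OF X, of y] P ij index_transpose_mat(1)[of i "proj_mat \<tau>" j] by (simp add: t)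
    have "q (?ei + ?ej) \<tau> = q ?ei \<tau> + q ?ej \<tau> + ?ei \<bullet> (proj_mat \<tau> *\<^sub>v ?ej) + ?ej \<bullet> (proj_mat \<tau> *\<^sub>v ?ei)"
      unfolding q_def using P
      by (simp add: mult_add_distrib_mat_vec[OF P] add_scalar_prod_distrib[of _ d] scalar_prod_add_distrib[of _ d]
           del: scalar_prod_left_unit)
    then show ?thesis using sym ij by (simp add: e)
  qed
  show ?thesis by (subst measurable_cong[OF eq]) (auto simp: meas)
qed

section \<open>The operator \<open>S\<close>\<close>

text \<open>Separates the projector from the conjugated matrix: the entry is linear in
  \<open>A\<close> with products of two projector entries as coefficients. All later exchanges with
  expectations rest on this expansion.\<close>

lemma sandwich_index:
  fixes P A :: rmat
  assumes P: "P \<in> carrier_mat d d" and A: "A \<in> carrier_mat d d" and ij: "i < d" "j < d"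
  shows "(P * A * P) $$ (i, j) = (\<Sum>a<d. \<Sum>b<d. P $$ (i, a) * P $$ (b, j) * A $$ (a, b))"
proof -
  have "(P * A * P) $$ (i, j) = (\<Sum>b<d. (P * A) $$ (i, b) * P $$ (b, j))"
    using P A ij by (simp add: scalar_prod_def lessThan_atLeast0 del: assoc_mult_mat)
  also have "\<dots> = (\<Sum>b<d. \<Sum>a<d. P $$ (i, a) * P $$ (b, j) * A $$ (a, b))"
    using P A ij by (intro sum.cong refl) (simp add: scalar_prod_def lessThan_atLeast0 sum_distrib_left sum_distrib_right mult_ac)
  also have "\<dots> = (\<Sum>a<d. \<Sum>b<d. P $$ (i, a) * P $$ (b, j) * A $$ (a, b))" by (rule sum.swap)
  finally show ?thesis .
qed

lemma proj_mat_task_carrier: "\<tau> \<in> tasks d \<Longrightarrow> proj_mat \<tau> \<in> carrier_mat d d"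
  by (auto elim!: tasksE intro: proj_mat_carrier)

lemma cov_mat_task_carrier: "\<tau> \<in> tasks d \<Longrightarrow> cov_mat \<tau> \<in> carrier_mat d d"
  by (auto elim!: tasksE simp: cov_mat_def)

lemma transpose_proj_mat_task: "\<tau> \<in> tasks d \<Longrightarrow> transpose_mat (proj_mat \<tau>) = proj_mat \<tau>"
  by (auto elim!: tasksE simp: transpose_proj_mat)

lemma frob_norm_sandwich_task_le:
  "\<tau> \<in> tasks d \<Longrightarrow> G \<in> carrier_mat d d \<Longrightarrow> frob_norm (proj_mat \<tau> * G * proj_mat \<tau>) \<le> frob_norm G"
  using frob_norm_sandwich_le by (auto elim!: tasksE simp del: assoc_mult_mat)

lemma sym_mats_index: "A \<in> sym_mats d \<Longrightarrow> i < d \<Longrightarrow> j < d \<Longrightarrow> A $$ (j, i) = A $$ (i, j)"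
  using index_transpose_mat(1)[of i A j] by (auto simp: sym_mats_def)

lemma integral_sum_sum:
  fixes f :: "'b \<Rightarrow> 'c \<Rightarrow> 'd \<Rightarrow> real"
  assumes "\<And>a b. a \<in> A \<Longrightarrow> b \<in> B \<Longrightarrow> integrable N (f a b)"
  shows "(\<integral>x. (\<Sum>a\<in>A. \<Sum>b\<in>B. f a b x) \<partial>N) = (\<Sum>a\<in>A. \<Sum>b\<in>B. \<integral>x. f a b x \<partial>N)"
proof -
  have "(\<integral>x. (\<Sum>a\<in>A. \<Sum>b\<in>B. f a b x) \<partial>N) = (\<Sum>a\<in>A. \<integral>x. (\<Sum>b\<in>B. f a b x) \<partial>N)"
    using assms by (intro Bochner_Integration.integral_sum Bochner_Integration.integrable_sum)
  also have "\<dots> = (\<Sum>a\<in>A. \<Sum>b\<in>B. \<integral>x. f a b x \<partial>N)"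
    using assms by (intro sum.cong refl Bochner_Integration.integral_sum)
  finally show ?thesis .
qed

lemma sandwich_sym_mats:
  assumes "\<tau> \<in> tasks d" "A \<in> sym_mats d"
  shows "proj_mat \<tau> * A * proj_mat \<tau> \<in> sym_mats d"
proof -
  have P: "proj_mat \<tau> \<in> carrier_mat d d" and A: "A \<in> carrier_mat d d" "transpose_mat A = A"
    using assms proj_mat_task_carrier by (auto simp: sym_mats_def)
  have PA: "proj_mat \<tau> * A \<in> carrier_mat d d" using P A by simp
  have "transpose_mat (proj_mat \<tau> * A * proj_mat \<tau>) = proj_mat \<tau> * (A * proj_mat \<tau>)"
    using transpose_mult[OF PA P] transpose_mult[OF P A(1)] A by (simp add: transpose_proj_mat_task[OF assms(1)])
  also have "\<dots> = proj_mat \<tau> * A * proj_mat \<tau>" using assoc_mult_mat[OF P A(1) P] by simp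
  finally show ?thesis using P A by (simp add: sym_mats_def)
qed

definition expect_mat :: "nat \<Rightarrow> 'b measure \<Rightarrow> ('b \<Rightarrow> rmat) \<Rightarrow> rmat" where
  "expect_mat d N F = Matrix.mat d d (\<lambda>(i, j). \<integral>x. F x $$ (i, j) \<partial>N)"

lemma expect_mat_carrier: "expect_mat d N F \<in> carrier_mat d d"
  by (simp add: expect_mat_def)

section \<open>Integrals against the law of one task\<close>

locale task_distribution = prob_space \<mu> for \<mu> :: "task measure" +
  fixes d :: nat
  assumes sets_eq: "sets \<mu> = sets (task_space d)"
begin

lemma space_eq: "space \<mu> = tasks d"
  using sets_eq_imp_space_eq[OF sets_eq] by (simp add: space_task_space)

lemma borel_measurable_eq: "borel_measurable \<mu> = borel_measurable (task_space d)"
  using sets_eq by (simp cong: measurable_cong_sets)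

lemma abs_proj_mat_prod_le_1:
  assumes "\<tau> \<in> tasks d" "i < d" "j < d" "a < d" "b < d"
  shows "\<bar>proj_mat \<tau> $$ (i, a) * proj_mat \<tau> $$ (b, j)\<bar> \<le> 1"
  using assms abs_proj_mat_le_1[of "fst \<tau>" _ d _ _ "snd \<tau>"]
  by (auto elim!: tasksE simp: abs_mult intro!: mult_le_one)

lemma integrable_mult_proj_mat:
  assumes h: "integrable \<mu> h" and ijab: "i < d" "j < d" "a < d" "b < d"
  shows "integrable \<mu> (\<lambda>\<tau>. h \<tau> * (proj_mat \<tau> $$ (i, a) * proj_mat \<tau> $$ (b, j)))"
proof (rule Bochner_Integration.integrable_bound[OF h])
  have [measurable]: "h \<in> borel_measurable \<mu>" using h by simp
  have [measurable]: "(\<lambda>\<tau>. proj_mat \<tau> $$ (i, a)) \<in> borel_measurable \<mu>" "(\<lambda>\<tau>. proj_mat \<tau> $$ (b, j)) \<in> borel_measurable \<mu>"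
    unfolding borel_measurable_eq using borel_measurable_proj_mat ijab by auto
  show "(\<lambda>\<tau>. h \<tau> * (proj_mat \<tau> $$ (i, a) * proj_mat \<tau> $$ (b, j))) \<in> borel_measurable \<mu>" by measurable
  have "\<bar>h \<tau>\<bar> * \<bar>proj_mat \<tau> $$ (i, a) * proj_mat \<tau> $$ (b, j)\<bar> \<le> \<bar>h \<tau>\<bar>" if "\<tau> \<in> space \<mu>" for \<tau>
    using that abs_proj_mat_prod_le_1[of \<tau> i j a b] ijab by (intro mult_left_le) (auto simp: space_eq)
  then show "AE \<tau> in \<mu>. norm (h \<tau> * (proj_mat \<tau> $$ (i, a) * proj_mat \<tau> $$ (b, j))) \<le> norm (h \<tau>)"
    by (intro AE_I2) (simp add: abs_mult)
qed

text \<open>The weight \<open>h\<close> serves two purposes: \<open>h = 1\<close> gives the entries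
  of \<open>S_op\<close>, and an entry of \<open>cov_mat\<close> gives the step at which loss and
  projector share a task.\<close>

lemma
  assumes h: "integrable \<mu> h" and A: "A \<in> carrier_mat d d" and ij: "i < d" "j < d"
  shows integrable_sandwich: "integrable \<mu> (\<lambda>\<tau>. h \<tau> * (proj_mat \<tau> * A * proj_mat \<tau>) $$ (i, j))"
    and integral_sandwich: "(\<integral>\<tau>. h \<tau> * (proj_mat \<tau> * A * proj_mat \<tau>) $$ (i, j) \<partial>\<mu>)
      = (\<Sum>a<d. \<Sum>b<d. (\<integral>\<tau>. h \<tau> * (proj_mat \<tau> $$ (i, a) * proj_mat \<tau> $$ (b, j)) \<partial>\<mu>) * A $$ (a, b))"
proof -
  let ?f = "\<lambda>\<tau>. \<Sum>a<d. \<Sum>b<d. h \<tau> * (proj_mat \<tau> $$ (i, a) * proj_mat \<tau> $$ (b, j)) * A $$ (a, b)"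
  have eq: "h \<tau> * (proj_mat \<tau> * A * proj_mat \<tau>) $$ (i, j) = ?f \<tau>" if "\<tau> \<in> space \<mu>" for \<tau>
    using sandwich_index[OF proj_mat_task_carrier A ij, of \<tau>] that
    by (simp add: space_eq sum_distrib_left mult.assoc)
  have int: "integrable \<mu> (\<lambda>\<tau>. h \<tau> * (proj_mat \<tau> $$ (i, a) * proj_mat \<tau> $$ (b, j)) * A $$ (a, b))"
    if "a < d" "b < d" for a b
    using integrable_mult_proj_mat[OF h ij that] by (rule integrable_mult_left)
  have "integrable \<mu> ?f" using int by (intro Bochner_Integration.integrable_sum) auto
  then show "integrable \<mu> (\<lambda>\<tau>. h \<tau> * (proj_mat \<tau> * A * proj_mat \<tau>) $$ (i, j))"
    using eq by (simp cong: Bochner_Integration.integrable_cong)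
  have "(\<integral>\<tau>. h \<tau> * (proj_mat \<tau> * A * proj_mat \<tau>) $$ (i, j) \<partial>\<mu>) = (\<integral>\<tau>. ?f \<tau> \<partial>\<mu>)"
    using eq by (intro Bochner_Integration.integral_cong) auto
  also have "\<dots> = (\<Sum>a<d. \<Sum>b<d. (\<integral>\<tau>. h \<tau> * (proj_mat \<tau> $$ (i, a) * proj_mat \<tau> $$ (b, j)) * A $$ (a, b) \<partial>\<mu>))"
    using int by (intro integral_sum_sum) auto
  also have "\<dots> = (\<Sum>a<d. \<Sum>b<d. (\<integral>\<tau>. h \<tau> * (proj_mat \<tau> $$ (i, a) * proj_mat \<tau> $$ (b, j)) \<partial>\<mu>) * A $$ (a, b))"
    by simp
  finally show "(\<integral>\<tau>. h \<tau> * (proj_mat \<tau> * A * proj_mat \<tau>) $$ (i, j) \<partial>\<mu>)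
      = (\<Sum>a<d. \<Sum>b<d. (\<integral>\<tau>. h \<tau> * (proj_mat \<tau> $$ (i, a) * proj_mat \<tau> $$ (b, j)) \<partial>\<mu>) * A $$ (a, b))" .
qed

section \<open>The operator norm of S and its powers\<close>

lemma S_op_carrier: "S_op d \<mu> A \<in> carrier_mat d d"
  by (simp add: S_op_def)

lemma S_op_index:
  assumes "A \<in> carrier_mat d d" "i < d" "j < d"
  shows "S_op d \<mu> A $$ (i, j)
    = (\<Sum>a<d. \<Sum>b<d. (\<integral>\<tau>. proj_mat \<tau> $$ (i, a) * proj_mat \<tau> $$ (b, j) \<partial>\<mu>) * A $$ (a, b))"
  using integral_sandwich[of "\<lambda>_. 1" A i j] assms by (simp add: S_op_def del: assoc_mult_mat)

lemma S_op_sym_mats: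
  assumes A: "A \<in> sym_mats d"
  shows "S_op d \<mu> A \<in> sym_mats d"
proof -
  have "(\<integral>\<tau>. (proj_mat \<tau> * A * proj_mat \<tau>) $$ (j, i) \<partial>\<mu>) = (\<integral>\<tau>. (proj_mat \<tau> * A * proj_mat \<tau>) $$ (i, j) \<partial>\<mu>)"
    if "i < d" "j < d" for i j
  proof (rule Bochner_Integration.integral_cong[OF refl])
    fix \<tau> assume "\<tau> \<in> space \<mu>"
    then have "proj_mat \<tau> * A * proj_mat \<tau> \<in> sym_mats d" using A by (simp add: space_eq sandwich_sym_mats)
    then show "(proj_mat \<tau> * A * proj_mat \<tau>) $$ (j, i) = (proj_mat \<tau> * A * proj_mat \<tau>) $$ (i, j)"
      using that by (rule sym_mats_index)
  qed
  then show ?thesis by (auto simp: sym_mats_def S_op_def intro!: eq_matI)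
qed

text \<open>Each conjugation is a contraction, so every averaged entry is at most
  \<open>frob_norm A\<close> in absolute value; the constant is the number of entries. The bound
  serves to show that the supremum defining \<open>rho\<close> is over a bounded set, and to treat
  matrices of norm zero.\<close>

lemma frob_norm_S_op_crude:
  assumes A: "A \<in> carrier_mat d d"
  shows "frob_norm (S_op d \<mu> A) \<le> real d * real d * frob_norm A"
proof -
  have "\<bar>S_op d \<mu> A $$ (i, j)\<bar> \<le> frob_norm A" if ij: "i < d" "j < d" for i j
  proof -
    have int: "integrable \<mu> (\<lambda>\<tau>. (proj_mat \<tau> * A * proj_mat \<tau>) $$ (i, j))"
      using integrable_sandwich[of "\<lambda>_. 1" A i j] A ij by simp
    have "\<bar>S_op d \<mu> A $$ (i, j)\<bar> \<le> (\<integral>\<tau>. \<bar>(proj_mat \<tau> * A * proj_mat \<tau>) $$ (i, j)\<bar> \<partial>\<mu>)"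
      using ij by (simp add: S_op_def integral_abs_bound del: assoc_mult_mat)
    also have "\<dots> \<le> frob_norm A"
    proof (rule integral_le_const)
      have "\<bar>(proj_mat \<tau> * A * proj_mat \<tau>) $$ (i, j)\<bar> \<le> frob_norm A" if "\<tau> \<in> tasks d" for \<tau>
      proof -
        have "proj_mat \<tau> * A * proj_mat \<tau> \<in> carrier_mat d d"
          using proj_mat_task_carrier[OF that] A by simp
        then show ?thesis
          using abs_index_le_frob_norm[OF _ ij] frob_norm_sandwich_task_le[OF that A] by fastforce
      qed
      then show "AE \<tau> in \<mu>. \<bar>(proj_mat \<tau> * A * proj_mat \<tau>) $$ (i, j)\<bar> \<le> frob_norm A"
        by (intro AE_I2) (simp add: space_eq)
    qed (use int in simp)
    finally show ?thesis .
  qed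
  then have "(\<Sum>i<d. \<Sum>j<d. \<bar>S_op d \<mu> A $$ (i, j)\<bar>) \<le> (\<Sum>i<d. \<Sum>j<d. frob_norm A)"
    by (intro sum_mono) auto
  then show ?thesis using frob_norm_le_sum[OF S_op_carrier, of A] by simp
qed

lemma bdd_above_S_op: "bdd_above ((\<lambda>A. frob_norm (S_op d \<mu> A) / frob_norm A) ` sym_mats d)"
proof (rule bdd_aboveI2)
  fix A assume "A \<in> sym_mats d"
  then have "frob_norm (S_op d \<mu> A) \<le> real d * real d * frob_norm A"
    by (intro frob_norm_S_op_crude) (simp add: sym_mats_def)
  then show "frob_norm (S_op d \<mu> A) / frob_norm A \<le> real d * real d"
    using frob_norm_nonneg[of A] by (cases "frob_norm A = 0") (auto simp: divide_le_eq)
qed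

lemma rho_nonneg: "0 \<le> rho d \<mu>"
proof -
  have "0\<^sub>m d d \<in> sym_mats d" by (simp add: sym_mats_def)
  then have "frob_norm (S_op d \<mu> (0\<^sub>m d d)) / frob_norm (0\<^sub>m d d) \<le> rho d \<mu>"
    unfolding rho_def frob_onorm_def by (intro cSUP_upper bdd_above_S_op)
  moreover have "0 \<le> frob_norm (S_op d \<mu> (0\<^sub>m d d)) / frob_norm (0\<^sub>m d d :: rmat)"
    by (intro divide_nonneg_nonneg frob_norm_nonneg)
  ultimately show ?thesis by linarith
qed

lemma frob_norm_S_op_le:
  assumes A: "A \<in> sym_mats d"
  shows "frob_norm (S_op d \<mu> A) \<le> rho d \<mu> * frob_norm A"
proof (cases "frob_norm A = 0")
  case True
  \<comment> \<open>At norm zero the quotient in \<open>rho\<close> is 0 by convention and says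
    nothing about the numerator; the crude bound shows that the numerator vanishes.\<close>
  then show ?thesis using frob_norm_S_op_crude[of A] A by (simp add: sym_mats_def)
next
  case False
  have "frob_norm (S_op d \<mu> A) / frob_norm A \<le> rho d \<mu>"
    unfolding rho_def frob_onorm_def by (intro cSUP_upper bdd_above_S_op A)
  then show ?thesis using False frob_norm_nonneg[of A] by (simp add: divide_le_eq)
qed

text \<open>Both claims are proved in one induction because \<open>rho\<close> controls only
  symmetric matrices, so each new factor needs the symmetry of the previous power.\<close>

lemma
  assumes A: "A \<in> sym_mats d"
  shows S_op_pow_sym_mats: "(S_op d \<mu> ^^ m) A \<in> sym_mats d"
    and frob_norm_S_op_pow_le: "frob_norm ((S_op d \<mu> ^^ m) A) \<le> rho d \<mu> ^ m * frob_norm A"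
proof (induction m)
  case (Suc m)
  {
    case 1
    show ?case using S_op_sym_mats[OF Suc(1)] by simp
  next
    case 2
    have "frob_norm ((S_op d \<mu> ^^ Suc m) A) \<le> rho d \<mu> * frob_norm ((S_op d \<mu> ^^ m) A)"
      using frob_norm_S_op_le[OF Suc(1)] by simp
    also have "\<dots> \<le> rho d \<mu> * (rho d \<mu> ^ m * frob_norm A)"
      by (intro mult_left_mono Suc(2) rho_nonneg)
    finally show ?case by (simp add: mult.assoc)
  }
qed (use A in auto)

section \<open>Linearity of S and exchange with expectations\<close>

lemma S_op_pow_carrier: "A \<in> carrier_mat d d \<Longrightarrow> (S_op d \<mu> ^^ m) A \<in> carrier_mat d d"
  by (cases m) (auto simp: S_op_carrier)

lemma S_op_smult:
  assumes A: "A \<in> carrier_mat d d"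
  shows "S_op d \<mu> (c \<cdot>\<^sub>m A) = c \<cdot>\<^sub>m S_op d \<mu> A"
proof (rule eq_matI)
  fix i j assume "i < dim_row (c \<cdot>\<^sub>m S_op d \<mu> A)" "j < dim_col (c \<cdot>\<^sub>m S_op d \<mu> A)"
  then have ij: "i < d" "j < d" using S_op_carrier[of A] by auto
  then show "S_op d \<mu> (c \<cdot>\<^sub>m A) $$ (i, j) = (c \<cdot>\<^sub>m S_op d \<mu> A) $$ (i, j)"
    using S_op_index[of "c \<cdot>\<^sub>m A" i j] S_op_index[OF A ij] A S_op_carrier[of A]
    by (simp add: sum_distrib_left mult_ac)
qed (simp_all add: S_op_def)

lemma S_op_pow_smult:
  assumes A: "A \<in> carrier_mat d d"
  shows "(S_op d \<mu> ^^ m) (c \<cdot>\<^sub>m A) = c \<cdot>\<^sub>m (S_op d \<mu> ^^ m) A"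
  by (induction m) (simp_all add: S_op_smult S_op_pow_carrier A)

text \<open>Each entry of \<open>S_op\<close> is a finite linear combination of the entries of its
  argument with the deterministic coefficients \<open>K\<close>, so it commutes with the expectation
  over any other space.\<close>

lemma
  assumes F: "\<And>x. x \<in> space N \<Longrightarrow> F x \<in> carrier_mat d d"
    and int: "\<And>i j. i < d \<Longrightarrow> j < d \<Longrightarrow> integrable N (\<lambda>x. F x $$ (i, j))"
  shows integrable_S_op: "i < d \<Longrightarrow> j < d \<Longrightarrow> integrable N (\<lambda>x. S_op d \<mu> (F x) $$ (i, j))"
    and S_op_expect_mat: "S_op d \<mu> (expect_mat d N F) = expect_mat d N (\<lambda>x. S_op d \<mu> (F x))"
proof -
  define K where "K i j a b = (\<integral>\<tau>. proj_mat \<tau> $$ (i, a) * proj_mat \<tau> $$ (b, j) \<partial>\<mu>)" for i j a b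
  have eq: "S_op d \<mu> (F x) $$ (i, j) = (\<Sum>a<d. \<Sum>b<d. K i j a b * F x $$ (a, b))"
    if "x \<in> space N" "i < d" "j < d" for x i j
    using S_op_index[OF F] that by (simp add: K_def)
  have "integrable N (\<lambda>x. \<Sum>a<d. \<Sum>b<d. K i j a b * F x $$ (a, b))" for i j
    by (intro Bochner_Integration.integrable_sum integrable_mult_right int) auto
  then show "i < d \<Longrightarrow> j < d \<Longrightarrow> integrable N (\<lambda>x. S_op d \<mu> (F x) $$ (i, j))" for i j
    by (simp add: eq cong: Bochner_Integration.integrable_cong)
  show "S_op d \<mu> (expect_mat d N F) = expect_mat d N (\<lambda>x. S_op d \<mu> (F x))"
  proof (rule eq_matI)
    fix i j assume "i < dim_row (expect_mat d N (\<lambda>x. S_op d \<mu> (F x)))" "j < dim_col (expect_mat d N (\<lambda>x. S_op d \<mu> (F x)))"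
    then have ij: "i < d" "j < d" by (simp_all add: expect_mat_def)
    have "S_op d \<mu> (expect_mat d N F) $$ (i, j) = (\<Sum>a<d. \<Sum>b<d. K i j a b * (\<integral>x. F x $$ (a, b) \<partial>N))"
      using S_op_index[OF expect_mat_carrier ij] by (simp add: K_def expect_mat_def)
    also have "\<dots> = (\<Sum>a<d. \<Sum>b<d. (\<integral>x. K i j a b * F x $$ (a, b) \<partial>N))" by simp
    also have "\<dots> = (\<integral>x. (\<Sum>a<d. \<Sum>b<d. K i j a b * F x $$ (a, b)) \<partial>N)"
      using int by (intro integral_sum_sum[symmetric]) auto
    also have "\<dots> = (\<integral>x. S_op d \<mu> (F x) $$ (i, j) \<partial>N)"
      using ij by (intro Bochner_Integration.integral_cong) (auto simp: eq)
    finally show "S_op d \<mu> (expect_mat d N F) $$ (i, j) = expect_mat d N (\<lambda>x. S_op d \<mu> (F x)) $$ (i, j)"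
      using ij by (simp add: expect_mat_def)
  qed (simp_all add: S_op_def expect_mat_def)
qed

lemma
  assumes F: "\<And>x. x \<in> space N \<Longrightarrow> F x \<in> carrier_mat d d"
    and int: "\<And>i j. i < d \<Longrightarrow> j < d \<Longrightarrow> integrable N (\<lambda>x. F x $$ (i, j))"
  shows integrable_S_op_pow: "\<And>i j. i < d \<Longrightarrow> j < d \<Longrightarrow> integrable N (\<lambda>x. (S_op d \<mu> ^^ m) (F x) $$ (i, j))"
    and S_op_pow_expect_mat: "(S_op d \<mu> ^^ m) (expect_mat d N F) = expect_mat d N (\<lambda>x. (S_op d \<mu> ^^ m) (F x))"
proof (induction m)
  case (Suc m)
  have c: "(S_op d \<mu> ^^ m) (F x) \<in> carrier_mat d d" if "x \<in> space N" for x
    by (rule S_op_pow_carrier[OF F[OF that]])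
  {
    case 1
    then show ?case using integrable_S_op[OF c Suc(1)] by simp
  next
    case 2
    show ?case using S_op_expect_mat[OF c Suc(1)] Suc(2) by simp
  }
qed (use int in auto)

text \<open>One averaging step. Independence is demanded of each entry of \<open>Y\<close> against
  every real function of the task, because it is applied to the combined factor of \<open>h\<close>
  and two projector entries. The weight may thus depend on the task performing the conjugation,
  while \<open>Y\<close> enters only through its mean.\<close>

lemma
  fixes M :: "'a measure"
  assumes M: "prob_space M" and T: "T \<in> measurable M (task_space d)" and distr: "distr M (task_space d) T = \<mu>"
    and Y: "\<And>x. x \<in> space M \<Longrightarrow> Y x \<in> carrier_mat d d"
    and intY: "\<And>a b. a < d \<Longrightarrow> b < d \<Longrightarrow> integrable M (\<lambda>x. Y x $$ (a, b))"
    and indep: "\<And>g a b. g \<in> borel_measurable (task_space d) \<Longrightarrow> a < d \<Longrightarrow> b < d \<Longrightarrow>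
      prob_space.indep_var M borel (\<lambda>x. g (T x) :: real) borel (\<lambda>x. Y x $$ (a, b))"
    and h: "integrable \<mu> h" and ij: "i < d" "j < d"
  shows integrable_sandwich_indep:
      "integrable M (\<lambda>x. h (T x) * (proj_mat (T x) * Y x * proj_mat (T x)) $$ (i, j))" (is ?I)
    and integral_sandwich_indep:
      "(\<integral>x. h (T x) * (proj_mat (T x) * Y x * proj_mat (T x)) $$ (i, j) \<partial>M)
        = (\<integral>\<tau>. h \<tau> * (proj_mat \<tau> * expect_mat d M Y * proj_mat \<tau>) $$ (i, j) \<partial>\<mu>)" (is ?E)
proof -
  interpret M: prob_space M by fact
  define g where "g a b \<tau> = h \<tau> * (proj_mat \<tau> $$ (i, a) * proj_mat \<tau> $$ (b, j))" for a b \<tau>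
  have intg: "integrable \<mu> (g a b)" if "a < d" "b < d" for a b
    unfolding g_def using integrable_mult_proj_mat[OF h ij that] .
  then have meas: "g a b \<in> borel_measurable (task_space d)" if "a < d" "b < d" for a b
    using that borel_measurable_eq by blast
  have intgT: "integrable M (\<lambda>x. g a b (T x))" and expg: "(\<integral>x. g a b (T x) \<partial>M) = (\<integral>\<tau>. g a b \<tau> \<partial>\<mu>)"
    if "a < d" "b < d" for a b
    using integrable_distr[OF T, of "g a b"] intg[OF that] integral_distr[OF T meas[OF that]] by (simp_all add: distr)
  let ?f = "\<lambda>x. \<Sum>a<d. \<Sum>b<d. g a b (T x) * Y x $$ (a, b)"
  have eq: "h (T x) * (proj_mat (T x) * Y x * proj_mat (T x)) $$ (i, j) = ?f x" if "x \<in> space M" for x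
  proof -
    have "T x \<in> tasks d" using measurable_space[OF T that] by (simp add: space_task_space)
    then show ?thesis using sandwich_index[OF proj_mat_task_carrier Y[OF that] ij]
      by (simp add: g_def sum_distrib_left mult.assoc)
  qed
  have int: "integrable M (\<lambda>x. g a b (T x) * Y x $$ (a, b))"
    and exp: "(\<integral>x. g a b (T x) * Y x $$ (a, b) \<partial>M) = (\<integral>\<tau>. g a b \<tau> \<partial>\<mu>) * (\<integral>x. Y x $$ (a, b) \<partial>M)"
    if ab: "a < d" "b < d" for a b
    using M.indep_var_integrable[OF indep[OF meas[OF ab] ab] intgT[OF ab] intY[OF ab]]
      M.indep_var_lebesgue_integral[OF indep[OF meas[OF ab] ab] intgT[OF ab] intY[OF ab]] expg[OF ab]
    by simp_all
  have "integrable M ?f" using int by (intro Bochner_Integration.integrable_sum) auto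
  then show ?I using eq by (simp cong: Bochner_Integration.integrable_cong)
  have "(\<integral>x. h (T x) * (proj_mat (T x) * Y x * proj_mat (T x)) $$ (i, j) \<partial>M) = (\<integral>x. ?f x \<partial>M)"
    using eq by (intro Bochner_Integration.integral_cong) auto
  also have "\<dots> = (\<Sum>a<d. \<Sum>b<d. (\<integral>\<tau>. g a b \<tau> \<partial>\<mu>) * (\<integral>x. Y x $$ (a, b) \<partial>M))"
    using int by (subst integral_sum_sum) (simp_all add: exp)
  also have "\<dots> = (\<integral>\<tau>. h \<tau> * (proj_mat \<tau> * expect_mat d M Y * proj_mat \<tau>) $$ (i, j) \<partial>\<mu>)"
    unfolding integral_sandwich[OF h expect_mat_carrier ij] by (simp add: g_def expect_mat_def)
  finally show ?E .
qed

end

section \<open>The error matrices\<close>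

lemma transpose_outer_prod: "transpose_mat (outer_prod v v) = outer_prod v v"
  by (auto simp: outer_prod_def intro!: eq_matI)

lemma outer_prod_sym_mats: "v \<in> carrier_vec d \<Longrightarrow> outer_prod v v \<in> sym_mats d"
  by (simp add: sym_mats_def transpose_outer_prod) (simp add: outer_prod_def)

lemma sandwich_outer_prod:
  assumes P: "P \<in> carrier_mat d d" "transpose_mat P = P" and v: "v \<in> carrier_vec d"
  shows "P * outer_prod v v * P = outer_prod (P *\<^sub>v v) (P *\<^sub>v v)"
proof (rule eq_matI)
  fix i j assume "i < dim_row (outer_prod (P *\<^sub>v v) (P *\<^sub>v v))" "j < dim_col (outer_prod (P *\<^sub>v v) (P *\<^sub>v v))"
  then have ij: "i < d" "j < d" using P by (simp_all add: outer_prod_def)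
  have o: "outer_prod v v \<in> carrier_mat d d" using v by (simp add: outer_prod_def)
  have sym: "P $$ (b, j) = P $$ (j, b)" if "b < d" for b
    using P that ij index_transpose_mat(1)[of b P j] by simp
  have "(P * outer_prod v v * P) $$ (i, j) = (\<Sum>a<d. \<Sum>b<d. (P $$ (i, a) * v $ a) * (P $$ (j, b) * v $ b))"
    unfolding sandwich_index[OF P(1) o ij] using v by (intro sum.cong refl) (simp add: outer_prod_def sym)
  also have "\<dots> = (\<Sum>a<d. P $$ (i, a) * v $ a) * (\<Sum>b<d. P $$ (j, b) * v $ b)"
    by (simp only: sum_product)
  also have "\<dots> = outer_prod (P *\<^sub>v v) (P *\<^sub>v v) $$ (i, j)"
    using P v ij by (simp add: outer_prod_def scalar_prod_def lessThan_atLeast0)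
  finally show "(P * outer_prod v v * P) $$ (i, j) = outer_prod (P *\<^sub>v v) (P *\<^sub>v v) $$ (i, j)" .
qed (use P in \<open>auto simp: outer_prod_def\<close>)

text \<open>Both sides are the quadratic form of the covariance at \<open>v\<close>; this makes the
  loss linear in the outer product of the error, and so accessible to averaging.\<close>

lemma frob_inner_cov_mat_outer_prod:
  assumes X: "X \<in> carrier_mat n d" and v: "v \<in> carrier_vec d"
  shows "frob_inner (cov_mat (X, y)) (outer_prod v v) = 1 / real n * norm2_sq (X *\<^sub>v v)"
proof -
  define A where "A = transpose_mat X * X"
  have A: "A \<in> carrier_mat d d" using X by (simp add: A_def)
  have "norm2_sq (X *\<^sub>v v) = (A *\<^sub>v v) \<bullet> v"
    unfolding norm2_sq_def A_def using scalar_prod_mult_mat_vec[OF X, of "X *\<^sub>v v" v] X v by simp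
  also have "\<dots> = (\<Sum>i<d. \<Sum>j<d. A $$ (i, j) * (v $ i * v $ j))"
    using A v by (simp add: scalar_prod_def lessThan_atLeast0 sum_distrib_left sum_distrib_right mult_ac)
  finally show ?thesis
    using X v A by (simp add: frob_inner_def cov_mat_def outer_prod_def sum_distrib_left mult.assoc
        flip: A_def)
qed

text \<open>The successive conjugation of \<open>G\<close> by the projectors of tasks 1 to
  \<open>s\<close>, with the latest task outermost.\<close>

fun chain :: "rmat \<Rightarrow> (nat \<Rightarrow> task) \<Rightarrow> nat \<Rightarrow> rmat" where
  "chain G T 0 = G"
| "chain G T (Suc s) = proj_mat (T (Suc s)) * chain G T s * proj_mat (T (Suc s))"

declare chain.simps(2)[simp del]

lemma chain_carrier:
  assumes G: "G \<in> carrier_mat d d" and T: "\<And>t. t \<in> {1..s} \<Longrightarrow> T t \<in> tasks d"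
  shows "chain G T s \<in> carrier_mat d d"
  using T
proof (induction s)
  case (Suc s)
  have "proj_mat (T (Suc s)) \<in> carrier_mat d d" by (rule proj_mat_task_carrier) (simp add: Suc.prems)
  moreover have "chain G T s \<in> carrier_mat d d" using Suc by simp
  ultimately show ?case by (simp add: chain.simps(2))
qed (simp add: G)

lemma frob_norm_chain_le:
  assumes G: "G \<in> carrier_mat d d" and T: "\<And>t. t \<in> {1..s} \<Longrightarrow> T t \<in> tasks d"
  shows "frob_norm (chain G T s) \<le> frob_norm G"
  using T
proof (induction s)
  case (Suc s)
  have "chain G T s \<in> carrier_mat d d" by (rule chain_carrier[OF G]) (simp add: Suc.prems)
  then have "frob_norm (chain G T (Suc s)) \<le> frob_norm (chain G T s)"
    using frob_norm_sandwich_task_le[of "T (Suc s)" d] Suc.prems by (simp add: chain.simps(2))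
  then show ?case using Suc by force
qed simp

text \<open>The chain sees only tasks 1 to \<open>s\<close>. This turns it into a function on a
  finite product space, the form in which independence of disjoint blocks of tasks is
  available.\<close>

lemma chain_restrict: "s \<le> m \<Longrightarrow> chain G (restrict T {1..m}) s = chain G T s"
  by (induction s) (simp_all add: chain.simps(2))

text \<open>The bound \<open>m\<close> stays fixed while \<open>s\<close> varies, so that the
  induction never changes the product space.\<close>

lemma borel_measurable_chain:
  assumes G: "G \<in> carrier_mat d d" and "s \<le> m" "i < d" "j < d"
  shows "(\<lambda>T. chain G T s $$ (i, j)) \<in> borel_measurable (PiM {1..m} (\<lambda>_. task_space d))"
  using assms(2-)
proof (induction s arbitrary: i j)
  case (Suc s)
  let ?N = "PiM {1..m} (\<lambda>_. task_space d)"
  have T: "T t \<in> tasks d" if "T \<in> space ?N" "t \<in> {1..m}" for T t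
    using that by (auto simp: space_PiM space_task_space)
  have comp: "(\<lambda>T. T (Suc s)) \<in> measurable ?N (task_space d)"
    using Suc.prems by (intro measurable_component_singleton) auto
  have eq: "chain G T (Suc s) $$ (i, j)
      = (\<Sum>a<d. \<Sum>b<d. proj_mat (T (Suc s)) $$ (i, a) * proj_mat (T (Suc s)) $$ (b, j) * chain G T s $$ (a, b))"
    if "T \<in> space ?N" for T
    using sandwich_index[OF proj_mat_task_carrier chain_carrier[OF G]] T[OF that] Suc.prems by (simp add: chain.simps(2))
  have "(\<lambda>T. \<Sum>a<d. \<Sum>b<d. proj_mat (T (Suc s)) $$ (i, a) * proj_mat (T (Suc s)) $$ (b, j) * chain G T s $$ (a, b))
      \<in> borel_measurable ?N"
    using Suc by (intro borel_measurable_sum borel_measurable_times Suc.IH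
        measurable_compose[OF comp borel_measurable_proj_mat]) auto
  then show ?case by (subst measurable_cong[OF eq]) auto
qed simp

text \<open>Here \<open>e\<close> is the error with its sign reversed, so it starts at
  \<open>w\<close> and each step projects it. Its outer product is therefore conjugated at each
  step, as the chain is, and the last conjunct keeps the fact that the latest projector maps into
  the null space of its own task.\<close>

lemma iterate_eq:
  assumes w: "w \<in> carrier_vec d"
    and T: "\<And>t. t \<in> {1..s} \<Longrightarrow> T t \<in> tasks d \<and> snd (T t) = fst (T t) *\<^sub>v w"
  shows "\<exists>e \<in> carrier_vec d. iterate d T s = w - e \<and> chain (outer_prod w w) T s = outer_prod e e
    \<and> (0 < s \<longrightarrow> fst (T s) *\<^sub>v e = 0\<^sub>v (dim_row (fst (T s))))"
  using T
proof (induction s)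
  case 0
  show ?case using w by (intro bexI[of _ w]) auto
next
  case (Suc s)
  then obtain e where e: "e \<in> carrier_vec d" "iterate d T s = w - e" "chain (outer_prod w w) T s = outer_prod e e"
    by fastforce
  have "T (Suc s) \<in> tasks d" using Suc.prems by simp
  then obtain X y n where t: "T (Suc s) = (X, y)" and X: "X \<in> carrier_mat n d"
    by (rule tasksE)
  have y: "y = X *\<^sub>v w" using Suc.prems[of "Suc s"] t by simp
  have P: "proj_mat (X, y) \<in> carrier_mat d d" by (rule proj_mat_carrier[OF X])
  have "iterate d T (Suc s) = w + proj_mat (X, y) *\<^sub>v (w - e - w)"
    using arg_min_on_exact_fit[OF X w, of "w - e" y] e w by (simp add: t y)
  also have "w - e - w = - e" using e w by (intro eq_vecI) auto
  also have "w + proj_mat (X, y) *\<^sub>v (- e) = w - proj_mat (X, y) *\<^sub>v e"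
    using P e w by (intro eq_vecI) auto
  finally have 1: "iterate d T (Suc s) = w - proj_mat (X, y) *\<^sub>v e" .
  have 2: "chain (outer_prod w w) T (Suc s) = outer_prod (proj_mat (X, y) *\<^sub>v e) (proj_mat (X, y) *\<^sub>v e)"
    using sandwich_outer_prod[OF P transpose_proj_mat[OF X] e(1)] by (simp add: e t chain.simps(2))
  have "X *\<^sub>v (proj_mat (X, y) *\<^sub>v e) = X * proj_mat (X, y) *\<^sub>v e"
    using X P e by simp
  also have "\<dots> = 0\<^sub>v n" using mult_proj_mat[OF X] e by (intro eq_vecI) auto
  finally have 3: "fst (T (Suc s)) *\<^sub>v (proj_mat (X, y) *\<^sub>v e) = 0\<^sub>v (dim_row (fst (T (Suc s))))"
    using X t by simp
  have "proj_mat (X, y) *\<^sub>v e \<in> carrier_vec d" using P e by simp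
  then show ?case using 1 2 3 by blast
qed

lemma
  assumes w: "w \<in> carrier_vec d"
    and T: "\<And>t. t \<in> {1..k} \<Longrightarrow> T t \<in> tasks d \<and> snd (T t) = fst (T t) *\<^sub>v w"
    and t: "t \<in> {1..k}"
  shows loss_iterate: "loss (T t) (iterate d T k) = frob_inner (cov_mat (T t)) (chain (outer_prod w w) T k)" (is ?A)
    and loss_last: "t = k \<Longrightarrow> loss (T t) (iterate d T k) = 0"
proof -
  obtain e where e: "e \<in> carrier_vec d" "iterate d T k = w - e" "chain (outer_prod w w) T k = outer_prod e e"
    and e0: "0 < k \<longrightarrow> fst (T k) *\<^sub>v e = 0\<^sub>v (dim_row (fst (T k)))"
    using iterate_eq[OF w, of k T] T by blast
  have "T t \<in> tasks d" using T t by simp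
  then obtain X y n where Tt: "T t = (X, y)" and X: "X \<in> carrier_mat n d"
    by (rule tasksE)
  have y: "y = X *\<^sub>v w" using T[OF t] Tt by simp
  have "X *\<^sub>v (w - e) - y = - (X *\<^sub>v e)"
    unfolding y mult_minus_distrib_mat_vec[OF X w e(1)] using X w e by (intro eq_vecI) auto
  then have loss: "loss (T t) (iterate d T k) = 1 / real n * norm2_sq (X *\<^sub>v e)"
    using X by (simp add: loss_def Tt e norm2_sq_def)
  then show ?A using frob_inner_cov_mat_outer_prod[OF X e(1), of y] by (simp add: Tt e)
  show "loss (T t) (iterate d T k) = 0" if "t = k"
    unfolding loss using e0 t that Tt X by (simp add: norm2_sq_def)
qed

section \<open>Averaging over independent tasks\<close>

locale task_process = task_distribution \<mu> d + M: prob_space M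
  for \<mu> :: "task measure" and d and M :: "'a measure" +
  fixes T :: "nat \<Rightarrow> 'a \<Rightarrow> task"
  assumes indep: "M.indep_vars (\<lambda>_. task_space d) T {1..}"
    and distr_eq: "\<And>t. t \<ge> 1 \<Longrightarrow> distr M (task_space d) (T t) = \<mu>"
    and integrable_cov: "integrable \<mu> (\<lambda>\<tau>. frob_norm (cov_mat \<tau>))"
begin

lemma measurable_T: "t \<ge> 1 \<Longrightarrow> T t \<in> measurable M (task_space d)"
  using indep by (auto simp: M.indep_vars_def)

lemma T_tasks: "t \<ge> 1 \<Longrightarrow> x \<in> space M \<Longrightarrow> T t x \<in> tasks d"
  using measurable_space[OF measurable_T] by (simp add: space_task_space)

text \<open>The index blocks \<open>{Suc s}\<close> and \<open>{1..s}\<close> are disjoint, so the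
  restricted families are independent, and independence passes to measurable functions of
  each.\<close>

lemma indep_past:
  fixes g f :: "_ \<Rightarrow> real"
  assumes g: "g \<in> borel_measurable (task_space d)"
    and f: "f \<in> borel_measurable (PiM {1..s} (\<lambda>_. task_space d))"
  shows "M.indep_var borel (\<lambda>x. g (T (Suc s) x)) borel (\<lambda>x. f (\<lambda>t\<in>{1..s}. T t x))"
proof -
  have "M.indep_var (PiM {Suc s} (\<lambda>_. task_space d)) (\<lambda>x. \<lambda>t\<in>{Suc s}. T t x)
      (PiM {1..s} (\<lambda>_. task_space d)) (\<lambda>x. \<lambda>t\<in>{1..s}. T t x)"
    by (rule M.indep_var_restrict[OF indep]) auto
  moreover have "(\<lambda>x. g (x (Suc s))) \<in> borel_measurable (PiM {Suc s} (\<lambda>_. task_space d))"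
    by (rule measurable_compose[OF _ g]) (intro measurable_component_singleton, simp)
  ultimately have "M.indep_var borel ((\<lambda>x. g (x (Suc s))) \<circ> (\<lambda>x. \<lambda>t\<in>{Suc s}. T t x))
      borel (f \<circ> (\<lambda>x. \<lambda>t\<in>{1..s}. T t x))"
    using f by (rule M.indep_var_compose)
  then show ?thesis by (simp add: comp_def)
qed

abbreviation Z :: "rmat \<Rightarrow> nat \<Rightarrow> 'a \<Rightarrow> rmat" where
  "Z G s x \<equiv> chain G (\<lambda>t. T t x) s"

lemma Z_carrier: "G \<in> carrier_mat d d \<Longrightarrow> x \<in> space M \<Longrightarrow> Z G s x \<in> carrier_mat d d"
  using T_tasks by (intro chain_carrier) auto

text \<open>No moment assumption enters: conjugations by projectors are contractions, so every entry
  is bounded by the norm of the starting matrix.\<close>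

lemma integrable_Z:
  assumes G: "G \<in> carrier_mat d d" and ij: "i < d" "j < d"
  shows "integrable M (\<lambda>x. Z G s x $$ (i, j))"
proof (rule M.integrable_const_bound)
  have "\<bar>Z G s x $$ (i, j)\<bar> \<le> frob_norm G" if "x \<in> space M" for x
    by (rule order.trans[OF abs_index_le_frob_norm[OF Z_carrier[OF G that] ij] frob_norm_chain_le[OF G]])
      (use T_tasks[OF _ that] in auto)
  then show "AE x in M. norm (Z G s x $$ (i, j)) \<le> frob_norm G" by (intro AE_I2) simp
  have "(\<lambda>x. \<lambda>t\<in>{1..s}. T t x) \<in> measurable M (PiM {1..s} (\<lambda>_. task_space d))"
    by (intro measurable_restrict measurable_T) auto
  from measurable_compose[OF this borel_measurable_chain[OF G order.refl ij]]
  show "(\<lambda>x. Z G s x $$ (i, j)) \<in> borel_measurable M"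
    unfolding chain_restrict[OF order.refl] .
qed

text \<open>Weight and outermost projector share task \<open>Suc s\<close>, so they stay together
  under one integral, while the chain up to \<open>s\<close> is independent of them and is replaced
  by its mean.\<close>

lemma
  assumes G: "G \<in> carrier_mat d d" and h: "integrable \<mu> h" and ij: "i < d" "j < d"
  shows integrable_weighted_Z: "integrable M (\<lambda>x. h (T (Suc s) x) * Z G (Suc s) x $$ (i, j))"
    and integral_weighted_Z: "(\<integral>x. h (T (Suc s) x) * Z G (Suc s) x $$ (i, j) \<partial>M)
      = (\<integral>\<tau>. h \<tau> * (proj_mat \<tau> * expect_mat d M (Z G s) * proj_mat \<tau>) $$ (i, j) \<partial>\<mu>)"
proof -
  have indep: "M.indep_var borel (\<lambda>x. g (T (Suc s) x)) borel (\<lambda>x. Z G s x $$ (a, b))"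
    if "g \<in> borel_measurable (task_space d)" "a < d" "b < d" for g :: "task \<Rightarrow> real" and a b
    using indep_past[OF that(1) borel_measurable_chain[OF G order.refl that(2,3)]]
    unfolding chain_restrict[OF order.refl] .
  have s: "Suc s \<ge> 1" by simp
  note facts = M.prob_space_axioms measurable_T[OF s] distr_eq[OF s] Z_carrier[OF G] integrable_Z[OF G] indep h ij
  show "integrable M (\<lambda>x. h (T (Suc s) x) * Z G (Suc s) x $$ (i, j))"
    unfolding chain.simps(2) by (rule integrable_sandwich_indep[OF facts])
  show "(\<integral>x. h (T (Suc s) x) * Z G (Suc s) x $$ (i, j) \<partial>M)
      = (\<integral>\<tau>. h \<tau> * (proj_mat \<tau> * expect_mat d M (Z G s) * proj_mat \<tau>) $$ (i, j) \<partial>\<mu>)"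
    unfolding chain.simps(2) by (rule integral_sandwich_indep[OF facts])
qed

lemma expect_mat_Z:
  assumes G: "G \<in> carrier_mat d d"
  shows "expect_mat d M (Z G s) = (S_op d \<mu> ^^ s) G"
proof (induction s)
  case 0
  show ?case using G by (auto simp: expect_mat_def M.prob_space intro!: eq_matI)
next
  case (Suc s)
  have "expect_mat d M (Z G (Suc s)) = S_op d \<mu> (expect_mat d M (Z G s))"
    unfolding expect_mat_def[of d M "Z G (Suc s)"] S_op_def
    using integral_weighted_Z[OF G, of "\<lambda>_. 1" _ _ s] by (intro eq_matI) (auto simp del: assoc_mult_mat)
  then show ?case using Suc by simp
qed

text \<open>The weight of task \<open>Suc s\<close> is absorbed into the matrix, so weight and chain
  together form the past of the next task. That task then acts with weight 1, which is one
  application of \<open>S_op\<close>.\<close>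

lemma
  assumes G: "G \<in> carrier_mat d d" and h: "integrable \<mu> h"
  shows integrable_weighted_Z_later: "\<And>i j. i < d \<Longrightarrow> j < d \<Longrightarrow>
      integrable M (\<lambda>x. h (T (Suc s) x) * Z G (Suc s + m) x $$ (i, j))"
    and expect_mat_weighted_Z_later: "expect_mat d M (\<lambda>x. h (T (Suc s) x) \<cdot>\<^sub>m Z G (Suc s + m) x)
      = (S_op d \<mu> ^^ m) (expect_mat d M (\<lambda>x. h (T (Suc s) x) \<cdot>\<^sub>m Z G (Suc s) x))"
proof (induction m)
  case 0
  {
    case 1
    then show ?case using integrable_weighted_Z[OF G h] by simp
  next
    case 2
    show ?case by simp
  }
next
  case (Suc m)
  let ?Y = "\<lambda>x. h (T (Suc s) x) \<cdot>\<^sub>m Z G (Suc s + m) x"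
  let ?T = "T (Suc (Suc s + m))"
  have Y: "?Y x \<in> carrier_mat d d" if "x \<in> space M" for x
    using Z_carrier[OF G that] by simp
  have Y_index: "?Y x $$ (i, j) = h (T (Suc s) x) * Z G (Suc s + m) x $$ (i, j)"
    if "x \<in> space M" "i < d" "j < d" for x i j
    using Z_carrier[OF G that(1), of "Suc s + m"] that by simp
  have intY: "integrable M (\<lambda>x. ?Y x $$ (i, j))" if ij: "i < d" "j < d" for i j
    using Suc(1)[OF ij] Y_index[OF _ ij] by (simp cong: Bochner_Integration.integrable_cong)
  have hm: "h \<in> borel_measurable (task_space d)" using borel_measurable_integrable[OF h] unfolding borel_measurable_eq .
  have indep: "M.indep_var borel (\<lambda>x. g (?T x)) borel (\<lambda>x. ?Y x $$ (a, b))"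
    if g: "g \<in> borel_measurable (task_space d)" and ab: "a < d" "b < d" for g :: "task \<Rightarrow> real" and a b
  proof -
    \<comment> \<open>The product ranges over all tasks up to \<open>Suc s + m\<close>, hence
      includes \<open>Suc s\<close>, so the weighted chain is a function of the past although its
      weight is fixed at an earlier task.\<close>
    let ?N = "PiM {1..Suc s + m} (\<lambda>_. task_space d)"
    let ?f = "\<lambda>U. (h (U (Suc s)) \<cdot>\<^sub>m chain G U (Suc s + m)) $$ (a, b)"
    have "(\<lambda>U. h (U (Suc s))) \<in> borel_measurable ?N"
      by (rule measurable_compose[OF _ hm]) (intro measurable_component_singleton, simp)
    then have "(\<lambda>U. h (U (Suc s)) * chain G U (Suc s + m) $$ (a, b)) \<in> borel_measurable ?N"
      by (rule borel_measurable_times[OF _ borel_measurable_chain[OF G order.refl ab]])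
    moreover have eq: "?f U = h (U (Suc s)) * chain G U (Suc s + m) $$ (a, b)" if "U \<in> space ?N" for U
    proof -
      have "chain G U (Suc s + m) \<in> carrier_mat d d"
        using that by (intro chain_carrier[OF G]) (auto simp: space_PiM space_task_space)
      then show ?thesis using ab by simp
    qed
    ultimately have "?f \<in> borel_measurable ?N" by (subst measurable_cong[OF eq]) auto
    from indep_past[OF g this] show ?thesis unfolding chain_restrict[OF order.refl] by simp
  qed
  have t: "Suc (Suc s + m) \<ge> 1" by simp
  note facts = M.prob_space_axioms measurable_T[OF t] distr_eq[OF t] Y intY indep
  have sandwich: "h (T (Suc s) x) * Z G (Suc s + Suc m) x $$ (i, j) = (proj_mat (?T x) * ?Y x * proj_mat (?T x)) $$ (i, j)"
    if x: "x \<in> space M" and ij: "i < d" "j < d" for x i j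
  proof -
    have P: "proj_mat (?T x) \<in> carrier_mat d d" using T_tasks[OF _ x] by (intro proj_mat_task_carrier) simp
    have Zc: "Z G (Suc s + m) x \<in> carrier_mat d d" by (rule Z_carrier[OF G x])
    have "proj_mat (?T x) * ?Y x * proj_mat (?T x) = h (T (Suc s) x) \<cdot>\<^sub>m Z G (Suc (Suc s + m)) x"
      using mult_smult_distrib[OF P Zc] mult_smult_assoc_mat[OF mult_carrier_mat[OF P Zc] P]
      by (simp add: chain.simps(2))
    moreover have "Z G (Suc (Suc s + m)) x \<in> carrier_mat d d" by (rule Z_carrier[OF G x])
    ultimately show ?thesis using ij by simp
  qed
  have sandwich_int: "integrable M (\<lambda>x. 1 * (proj_mat (?T x) * ?Y x * proj_mat (?T x)) $$ (i, j))"
    and sandwich_eq: "(\<integral>x. 1 * (proj_mat (?T x) * ?Y x * proj_mat (?T x)) $$ (i, j) \<partial>M)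
      = (\<integral>\<tau>. 1 * (proj_mat \<tau> * expect_mat d M ?Y * proj_mat \<tau>) $$ (i, j) \<partial>\<mu>)" if ij: "i < d" "j < d" for i j
    using integrable_sandwich_indep[OF facts integrable_const ij, of 1]
      integral_sandwich_indep[OF facts integrable_const ij, of 1] by blast+
  {
    case (1 i j)
    then show ?case using sandwich_int[OF 1] sandwich[OF _ 1] by (simp cong: Bochner_Integration.integrable_cong)
  next
    case 2
    have "expect_mat d M (\<lambda>x. h (T (Suc s) x) \<cdot>\<^sub>m Z G (Suc s + Suc m) x) = S_op d \<mu> (expect_mat d M ?Y)"
    proof (rule eq_matI)
      fix i j assume "i < dim_row (S_op d \<mu> (expect_mat d M ?Y))" "j < dim_col (S_op d \<mu> (expect_mat d M ?Y))"
      then have ij: "i < d" "j < d" by (simp_all add: S_op_def)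
      have "(\<integral>x. (h (T (Suc s) x) \<cdot>\<^sub>m Z G (Suc s + Suc m) x) $$ (i, j) \<partial>M)
          = (\<integral>x. 1 * (proj_mat (?T x) * ?Y x * proj_mat (?T x)) $$ (i, j) \<partial>M)"
      proof (rule Bochner_Integration.integral_cong[OF refl])
        fix x assume x: "x \<in> space M"
        show "(h (T (Suc s) x) \<cdot>\<^sub>m Z G (Suc s + Suc m) x) $$ (i, j)
          = 1 * (proj_mat (?T x) * ?Y x * proj_mat (?T x)) $$ (i, j)"
          using sandwich[OF x ij] Z_carrier[OF G x, of "Suc s + Suc m"] ij by (simp del: add_Suc_right)
      qed
      then show "expect_mat d M (\<lambda>x. h (T (Suc s) x) \<cdot>\<^sub>m Z G (Suc s + Suc m) x) $$ (i, j) = S_op d \<mu> (expect_mat d M ?Y) $$ (i, j)"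
        using sandwich_eq[OF ij] ij unfolding expect_mat_def S_op_def by (simp del: assoc_mult_mat add_Suc_right)
    qed (simp_all add: S_op_def expect_mat_def)
    then show ?case using Suc(2) by simp
  }
qed

lemma integrable_cov_index:
  assumes ij: "i < d" "j < d"
  shows "integrable \<mu> (\<lambda>\<tau>. cov_mat \<tau> $$ (i, j))"
proof (rule Bochner_Integration.integrable_bound[OF integrable_cov])
  show "(\<lambda>\<tau>. cov_mat \<tau> $$ (i, j)) \<in> borel_measurable \<mu>"
    unfolding borel_measurable_eq by (rule borel_measurable_cov_mat[OF ij])
  show "AE \<tau> in \<mu>. norm (cov_mat \<tau> $$ (i, j)) \<le> norm (frob_norm (cov_mat \<tau>))"
    using abs_index_le_frob_norm[OF cov_mat_task_carrier ij] frob_norm_nonneg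
    by (intro AE_I2) (simp add: space_eq)
qed

text \<open>With t = s + 1 and k = s + 1 + m, the \<open>s\<close> steps before task
  \<open>t\<close> and the \<open>m\<close> steps after it together give the exponent s + m = k - 1.
  Cauchy-Schwarz is applied under the single-task integral, so only the first moment of the
  covariance norm appears.\<close>

lemma
  assumes G: "G \<in> sym_mats d"
  shows integrable_cov_Z: "integrable M (\<lambda>x. frob_inner (cov_mat (T (Suc s) x)) (Z G (Suc s + m) x))"
    and integral_cov_Z_le: "(\<integral>x. frob_inner (cov_mat (T (Suc s) x)) (Z G (Suc s + m) x) \<partial>M)
      \<le> rho d \<mu> ^ (s + m) * frob_norm G * (\<integral>\<tau>. frob_norm (cov_mat \<tau>) \<partial>\<mu>)"
proof -
  have Gc: "G \<in> carrier_mat d d" using G by (simp add: sym_mats_def)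
  define H where "H = (S_op d \<mu> ^^ s) G"
  have H: "H \<in> sym_mats d" unfolding H_def by (rule S_op_pow_sym_mats[OF G])
  then have Hc: "H \<in> carrier_mat d d" by (simp add: sym_mats_def)
  \<comment> \<open>The mean of the chain after \<open>Suc s + m\<close> steps when task
    \<open>Suc s\<close> is fixed to be \<open>\<tau>\<close>: \<open>H\<close> averages the tasks
    before it, and the power of \<open>S_op\<close> those after it.\<close>
  define K where "K \<tau> = (S_op d \<mu> ^^ m) (proj_mat \<tau> * H * proj_mat \<tau>)" for \<tau>
  have PHP: "proj_mat \<tau> * H * proj_mat \<tau> \<in> sym_mats d" if "\<tau> \<in> tasks d" for \<tau>
    by (rule sandwich_sym_mats[OF that H])
  have PHPc: "proj_mat \<tau> * H * proj_mat \<tau> \<in> carrier_mat d d" if "\<tau> \<in> tasks d" for \<tau>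
    using PHP[OF that] by (simp add: sym_mats_def)
  have Kc: "K \<tau> \<in> carrier_mat d d" if "\<tau> \<in> tasks d" for \<tau>
    unfolding K_def using S_op_pow_carrier[OF PHPc[OF that]] .
  have K_le: "frob_norm (K \<tau>) \<le> rho d \<mu> ^ (s + m) * frob_norm G" if \<tau>: "\<tau> \<in> tasks d" for \<tau>
  proof -
    have "frob_norm (K \<tau>) \<le> rho d \<mu> ^ m * frob_norm (proj_mat \<tau> * H * proj_mat \<tau>)"
      unfolding K_def by (rule frob_norm_S_op_pow_le[OF PHP[OF \<tau>]])
    also have "\<dots> \<le> rho d \<mu> ^ m * frob_norm H"
      by (intro mult_left_mono frob_norm_sandwich_task_le[OF \<tau> Hc] zero_le_power rho_nonneg)
    also have "\<dots> \<le> rho d \<mu> ^ m * (rho d \<mu> ^ s * frob_norm G)"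
      unfolding H_def by (intro mult_left_mono frob_norm_S_op_pow_le[OF G] zero_le_power rho_nonneg)
    finally show ?thesis by (simp add: power_add mult_ac)
  qed
  have inner: "frob_inner (cov_mat \<tau>) B = (\<Sum>i<d. \<Sum>j<d. cov_mat \<tau> $$ (i, j) * B $$ (i, j))"
    if "\<tau> \<in> tasks d" for \<tau> B
    using cov_mat_task_carrier[OF that] by (simp add: frob_inner_def)
  have term_int: "integrable M (\<lambda>x. cov_mat (T (Suc s) x) $$ (i, j) * Z G (Suc s + m) x $$ (i, j))"
    if "i < d" "j < d" for i j
    by (rule integrable_weighted_Z_later[OF Gc integrable_cov_index[OF that] that])
  have cK: "(\<integral>x. cov_mat (T (Suc s) x) $$ (i, j) * Z G (Suc s + m) x $$ (i, j) \<partial>M)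
      = (\<integral>\<tau>. cov_mat \<tau> $$ (i, j) * K \<tau> $$ (i, j) \<partial>\<mu>)"
    and cK_int: "integrable \<mu> (\<lambda>\<tau>. cov_mat \<tau> $$ (i, j) * K \<tau> $$ (i, j))"
    if ij: "i < d" "j < d" for i j
  proof -
    \<comment> \<open>Only entry \<open>(i, j)\<close> of the chain is paired with this weight, but
      the later applications of \<open>S_op\<close> mix entries, so the whole matrix scaled by
      \<open>h\<close> is followed and the entry is read off at the end.\<close>
    define h where "h \<tau> = cov_mat \<tau> $$ (i, j)" for \<tau>
    have h: "integrable \<mu> h" unfolding h_def by (rule integrable_cov_index[OF ij])
    let ?F = "\<lambda>\<tau>. h \<tau> \<cdot>\<^sub>m (proj_mat \<tau> * H * proj_mat \<tau>)"
    have F: "?F \<tau> \<in> carrier_mat d d" if "\<tau> \<in> space \<mu>" for \<tau>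
      using PHPc that by (simp add: space_eq)
    have F_index: "?F \<tau> $$ (a, b) = h \<tau> * (proj_mat \<tau> * H * proj_mat \<tau>) $$ (a, b)"
      if "\<tau> \<in> space \<mu>" "a < d" "b < d" for \<tau> a b
      using PHPc[of \<tau>] that unfolding space_eq by (intro index_smult_mat(1)) auto
    have F_int: "integrable \<mu> (\<lambda>\<tau>. ?F \<tau> $$ (a, b))" if ab: "a < d" "b < d" for a b
      using integrable_sandwich[OF h Hc ab] F_index[OF _ ab] by (simp cong: Bochner_Integration.integrable_cong)
    have hZ: "expect_mat d M (\<lambda>x. h (T (Suc s) x) \<cdot>\<^sub>m Z G (Suc s) x) = expect_mat d \<mu> ?F"
    proof (rule eq_matI)
      fix a b assume "a < dim_row (expect_mat d \<mu> ?F)" "b < dim_col (expect_mat d \<mu> ?F)"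
      then have ab: "a < d" "b < d" by (simp_all add: expect_mat_def)
      have "(\<integral>x. (h (T (Suc s) x) \<cdot>\<^sub>m Z G (Suc s) x) $$ (a, b) \<partial>M) = (\<integral>x. h (T (Suc s) x) * Z G (Suc s) x $$ (a, b) \<partial>M)"
      proof (rule Bochner_Integration.integral_cong[OF refl])
        fix x assume "x \<in> space M"
        then show "(h (T (Suc s) x) \<cdot>\<^sub>m Z G (Suc s) x) $$ (a, b) = h (T (Suc s) x) * Z G (Suc s) x $$ (a, b)"
          using Z_carrier[OF Gc, of x "Suc s"] ab by simp
      qed
      also have "\<dots> = (\<integral>\<tau>. h \<tau> * (proj_mat \<tau> * H * proj_mat \<tau>) $$ (a, b) \<partial>\<mu>)"
        unfolding integral_weighted_Z[OF Gc h ab] expect_mat_Z[OF Gc] H_def ..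
      also have "\<dots> = (\<integral>\<tau>. ?F \<tau> $$ (a, b) \<partial>\<mu>)"
        by (intro Bochner_Integration.integral_cong[OF refl]) (rule F_index[OF _ ab, symmetric])
      finally show "expect_mat d M (\<lambda>x. h (T (Suc s) x) \<cdot>\<^sub>m Z G (Suc s) x) $$ (a, b) = expect_mat d \<mu> ?F $$ (a, b)"
        using ab unfolding expect_mat_def by (simp del: assoc_mult_mat)
    qed (simp_all add: expect_mat_def)
    \<comment> \<open>For fixed \<open>\<tau>\<close> the weight is a scalar, so homogeneity pulls
      it out of the power of \<open>S_op\<close>.\<close>
    have SF: "(S_op d \<mu> ^^ m) (?F \<tau>) $$ (i, j) = h \<tau> * K \<tau> $$ (i, j)" if "\<tau> \<in> space \<mu>" for \<tau>
      unfolding S_op_pow_smult[OF PHPc[OF that[unfolded space_eq]]] K_def[symmetric]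
      using Kc[OF that[unfolded space_eq]] ij by simp
    have "(\<integral>x. cov_mat (T (Suc s) x) $$ (i, j) * Z G (Suc s + m) x $$ (i, j) \<partial>M)
        = expect_mat d M (\<lambda>x. h (T (Suc s) x) \<cdot>\<^sub>m Z G (Suc s + m) x) $$ (i, j)"
    proof -
      have "(\<integral>x. cov_mat (T (Suc s) x) $$ (i, j) * Z G (Suc s + m) x $$ (i, j) \<partial>M)
        = (\<integral>x. (h (T (Suc s) x) \<cdot>\<^sub>m Z G (Suc s + m) x) $$ (i, j) \<partial>M)"
      proof (rule Bochner_Integration.integral_cong[OF refl])
        fix x assume "x \<in> space M"
        then show "cov_mat (T (Suc s) x) $$ (i, j) * Z G (Suc s + m) x $$ (i, j) = (h (T (Suc s) x) \<cdot>\<^sub>m Z G (Suc s + m) x) $$ (i, j)"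
          using Z_carrier[OF Gc, of x "Suc s + m"] ij by (simp add: h_def)
      qed
      then show ?thesis using ij by (simp add: expect_mat_def)
    qed
    also have "\<dots> = (S_op d \<mu> ^^ m) (expect_mat d \<mu> ?F) $$ (i, j)"
      unfolding expect_mat_weighted_Z_later[OF Gc h] hZ ..
    also have "\<dots> = expect_mat d \<mu> (\<lambda>\<tau>. (S_op d \<mu> ^^ m) (?F \<tau>)) $$ (i, j)"
      using S_op_pow_expect_mat[OF F F_int] by simp
    also have "\<dots> = (\<integral>\<tau>. (S_op d \<mu> ^^ m) (?F \<tau>) $$ (i, j) \<partial>\<mu>)"
      unfolding expect_mat_def using ij by simp
    also have "\<dots> = (\<integral>\<tau>. cov_mat \<tau> $$ (i, j) * K \<tau> $$ (i, j) \<partial>\<mu>)"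
      unfolding h_def[symmetric] by (intro Bochner_Integration.integral_cong[OF refl] SF)
    finally show "(\<integral>x. cov_mat (T (Suc s) x) $$ (i, j) * Z G (Suc s + m) x $$ (i, j) \<partial>M)
      = (\<integral>\<tau>. cov_mat \<tau> $$ (i, j) * K \<tau> $$ (i, j) \<partial>\<mu>)" .
    have "integrable \<mu> (\<lambda>\<tau>. (S_op d \<mu> ^^ m) (?F \<tau>) $$ (i, j))"
      by (rule integrable_S_op_pow[OF F F_int ij])
    then show "integrable \<mu> (\<lambda>\<tau>. cov_mat \<tau> $$ (i, j) * K \<tau> $$ (i, j))"
      using SF by (simp add: h_def cong: Bochner_Integration.integrable_cong)
  qed
  have inner_Z: "frob_inner (cov_mat (T (Suc s) x)) (Z G (Suc s + m) x)
      = (\<Sum>i<d. \<Sum>j<d. cov_mat (T (Suc s) x) $$ (i, j) * Z G (Suc s + m) x $$ (i, j))" if "x \<in> space M" for x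
    using inner T_tasks[OF _ that] by simp
  have "integrable M (\<lambda>x. \<Sum>i<d. \<Sum>j<d. cov_mat (T (Suc s) x) $$ (i, j) * Z G (Suc s + m) x $$ (i, j))"
    using term_int by (intro Bochner_Integration.integrable_sum) auto
  then show "integrable M (\<lambda>x. frob_inner (cov_mat (T (Suc s) x)) (Z G (Suc s + m) x))"
    by (simp only: inner_Z cong: Bochner_Integration.integrable_cong)
  have "(\<integral>x. frob_inner (cov_mat (T (Suc s) x)) (Z G (Suc s + m) x) \<partial>M)
      = (\<integral>x. (\<Sum>i<d. \<Sum>j<d. cov_mat (T (Suc s) x) $$ (i, j) * Z G (Suc s + m) x $$ (i, j)) \<partial>M)"
    by (intro Bochner_Integration.integral_cong[OF refl] inner_Z)
  also have "\<dots> = (\<Sum>i<d. \<Sum>j<d. \<integral>x. cov_mat (T (Suc s) x) $$ (i, j) * Z G (Suc s + m) x $$ (i, j) \<partial>M)"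
    using term_int by (intro integral_sum_sum) auto
  also have "\<dots> = (\<Sum>i<d. \<Sum>j<d. \<integral>\<tau>. cov_mat \<tau> $$ (i, j) * K \<tau> $$ (i, j) \<partial>\<mu>)"
    using cK by (intro sum.cong refl) auto
  also have "\<dots> = (\<integral>\<tau>. (\<Sum>i<d. \<Sum>j<d. cov_mat \<tau> $$ (i, j) * K \<tau> $$ (i, j)) \<partial>\<mu>)"
    using cK_int by (intro integral_sum_sum[symmetric]) auto
  also have "\<dots> \<le> (\<integral>\<tau>. rho d \<mu> ^ (s + m) * frob_norm G * frob_norm (cov_mat \<tau>) \<partial>\<mu>)"
  proof (rule integral_mono)
    show "integrable \<mu> (\<lambda>\<tau>. \<Sum>i<d. \<Sum>j<d. cov_mat \<tau> $$ (i, j) * K \<tau> $$ (i, j))"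
      using cK_int by (intro Bochner_Integration.integrable_sum) auto
    show "integrable \<mu> (\<lambda>\<tau>. rho d \<mu> ^ (s + m) * frob_norm G * frob_norm (cov_mat \<tau>))"
      by (intro integrable_mult_right integrable_cov)
    fix \<tau> assume "\<tau> \<in> space \<mu>"
    then have \<tau>: "\<tau> \<in> tasks d" by (simp add: space_eq)
    have "frob_inner (cov_mat \<tau>) (K \<tau>) \<le> frob_norm (cov_mat \<tau>) * frob_norm (K \<tau>)"
      by (rule frob_inner_le[OF cov_mat_task_carrier[OF \<tau>] Kc[OF \<tau>]])
    also have "\<dots> \<le> frob_norm (cov_mat \<tau>) * (rho d \<mu> ^ (s + m) * frob_norm G)"
      by (intro mult_left_mono K_le[OF \<tau>] frob_norm_nonneg)
    finally show "(\<Sum>i<d. \<Sum>j<d. cov_mat \<tau> $$ (i, j) * K \<tau> $$ (i, j)) \<le> rho d \<mu> ^ (s + m) * frob_norm G * frob_norm (cov_mat \<tau>)"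
      unfolding inner[OF \<tau>] by (simp add: mult_ac)
  qed
  finally show "(\<integral>x. frob_inner (cov_mat (T (Suc s) x)) (Z G (Suc s + m) x) \<partial>M)
      \<le> rho d \<mu> ^ (s + m) * frob_norm G * (\<integral>\<tau>. frob_norm (cov_mat \<tau>) \<partial>\<mu>)" by simp
qed

end

section \<open>The forgetting bound\<close>

theorem theorem4p2:
  fixes d k :: nat
    and w_star :: rvec
    and \<mu> :: "task measure"
    and M :: "'a measure"
    and T :: "nat \<Rightarrow> 'a \<Rightarrow> task"
  assumes "prob_space \<mu>" and "sets \<mu> = sets (task_space d)"
    and "w_star \<in> carrier_vec d" and "AE (X, y) in \<mu>. y = X *\<^sub>v w_star"
    and "prob_space M"
    and "prob_space.indep_vars M (\<lambda>_. task_space d) T {1..}"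
    and "\<And>t. t \<ge> 1 \<Longrightarrow> distr M (task_space d) (T t) = \<mu>"
    and "integrable \<mu> (\<lambda>\<tau>. frob_norm (cov_mat \<tau>))"
    and "k \<ge> 2"
  shows "forgetting d M T k
    \<le> (real k - 1) / real k * rho d \<mu> ^ (k - 1) * frob_norm (outer_prod w_star w_star)
        * (\<integral>\<tau>. frob_norm (cov_mat \<tau>) \<partial>\<mu>)"
proof -
  interpret task_process \<mu> d M T
    using assms by (auto intro!: task_process.intro task_distribution.intro
        simp: task_distribution_axioms_def task_process_axioms_def)
  define G where "G = outer_prod w_star w_star"
  have G: "G \<in> sym_mats d" unfolding G_def by (rule outer_prod_sym_mats[OF assms(3)])
  define B where "B = rho d \<mu> ^ (k - 1) * frob_norm G * (\<integral>\<tau>. frob_norm (cov_mat \<tau>) \<partial>\<mu>)"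
  \<comment> \<open>Covers the non-integrable case below, in which the Bochner integral is 0 by
    convention.\<close>
  have B_nonneg: "0 \<le> B"
    unfolding B_def by (intro mult_nonneg_nonneg zero_le_power rho_nonneg frob_norm_nonneg
        Bochner_Integration.integral_nonneg)
  let ?l = "\<lambda>x. 1 / real k * (\<Sum>t=1..k. loss (T t x) (iterate d (\<lambda>s. T s x) k))"
  let ?c = "\<lambda>t x. frob_inner (cov_mat (T t x)) (Z G k x)"
  have bound: "integrable M (?c t)" "(\<integral>x. ?c t x \<partial>M) \<le> B" if t: "t \<in> {1..<k}" for t
  proof -
    \<comment> \<open>The splitting k = (s + 1) + m makes the exponent s + m equal to k - 1 for
      every \<open>t\<close>, so one constant \<open>B\<close> serves all the summands.\<close>
    obtain s where s: "t = Suc s" using t by (cases t) auto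
    then obtain m where m: "k = Suc s + m" using t less_imp_add_positive[of t k] by auto
    show "integrable M (?c t)" "(\<integral>x. ?c t x \<partial>M) \<le> B"
      using integrable_cov_Z[OF G, of s m] integral_cov_Z_le[OF G, of s m] by (simp_all add: s m B_def)
  qed
  \<comment> \<open>The common solution is guaranteed only almost surely, and elsewhere the feasible
    set may be empty and the iterate an arbitrary choice. Measurability of \<open>?l\<close>, needed
    to replace it by an almost surely equal function, is therefore drawn from integrability by case
    distinction.\<close>
  have "(\<integral>x. ?l x \<partial>M) \<le> (real k - 1) / real k * B"
  proof (cases "integrable M ?l")
    case True
    have "AE x in M. snd (T t x) = fst (T t x) *\<^sub>v w_star" if "t \<in> {1..k}" for t
    proof -
      have "distr M (task_space d) (T t) = \<mu>" using distr_eq that by simp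
      moreover have "AE \<tau> in \<mu>. snd \<tau> = fst \<tau> *\<^sub>v w_star"
        using assms(4) by (simp add: case_prod_beta)
      ultimately have "AE \<tau> in distr M (task_space d) (T t). snd \<tau> = fst \<tau> *\<^sub>v w_star"
        \<comment> \<open>The identity is assumed for the law of a task; the distribution of each
          \<open>T t\<close> transfers it to the sample space, and finitely many null sets are then
          combined.\<close>
        by (simp only:)
      then show ?thesis using measurable_T[of t] that by (intro AE_distrD[of "T t"]) auto
    qed
    then have "AE x in M. \<forall>t\<in>{1..k}. snd (T t x) = fst (T t x) *\<^sub>v w_star"
      by (intro AE_finite_allI) auto
    then have "AE x in M. ?l x = 1 / real k * (\<Sum>t=1..<k. ?c t x)"
    proof (rule AE_mp, intro AE_I2 impI)
      fix x assume x: "x \<in> space M" "\<forall>t\<in>{1..k}. snd (T t x) = fst (T t x) *\<^sub>v w_star"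
      have tasks: "T t x \<in> tasks d \<and> snd (T t x) = fst (T t x) *\<^sub>v w_star" if "t \<in> {1..k}" for t
        using that x T_tasks by auto
      \<comment> \<open>Splitting off task \<open>k\<close>, whose loss vanishes, leaves k - 1
        summands; this is the origin of the factor (k - 1)/k.\<close>
      have "{1..k} = insert k {1..<k}" using assms(9) by auto
      then have "(\<Sum>t=1..k. loss (T t x) (iterate d (\<lambda>s. T s x) k))
          = (\<Sum>t=1..<k. loss (T t x) (iterate d (\<lambda>s. T s x) k))"
        using loss_last[OF assms(3), of k "\<lambda>s. T s x" k] tasks assms(9) by simp
      also have "\<dots> = (\<Sum>t=1..<k. ?c t x)"
        unfolding G_def by (intro sum.cong refl loss_iterate[OF assms(3), where T = "\<lambda>s. T s x"] tasks) auto
      finally show "?l x = 1 / real k * (\<Sum>t=1..<k. ?c t x)" by simp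
    qed
    then have "(\<integral>x. ?l x \<partial>M) = (\<integral>x. 1 / real k * (\<Sum>t=1..<k. ?c t x) \<partial>M)"
      using True bound(1) by (intro integral_cong_AE) auto
    also have "\<dots> = 1 / real k * (\<Sum>t=1..<k. \<integral>x. ?c t x \<partial>M)"
      using bound(1) by (simp add: Bochner_Integration.integral_sum)
    also have "\<dots> \<le> 1 / real k * (\<Sum>t=1..<k. B)"
      using bound(2) by (intro mult_left_mono sum_mono) auto
    also have "\<dots> = (real k - 1) / real k * B" using assms(9) by (simp add: of_nat_diff)
    finally show ?thesis .
  next
    case False
    then have "(\<integral>x. ?l x \<partial>M) = 0" by (rule not_integrable_integral_eq)
    then show ?thesis using B_nonneg assms(9) by simp
  qed
  then show ?thesis by (simp add: forgetting_def B_def G_def mult.assoc)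
qed

end
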